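(* Let $b\ge 3$ and $m\ge 2$ be integers. For any $\omega=\omega^0\omega^1\ldots\in (D_b^m)^{\mathbb{N}_0}$ we have $$\dim_H K^{\omega} = \underline{\dim}_B K^{\omega} = \liminf_{n \to \infty} \frac{\log |\Sigma_n^{\omega}|}{n \log b }=\liminf_{n\to\infty}\frac{1}{n \log b}\log \|A_{\omega^0}A_{\omega^1}\cdots A_{\omega^{n-1}}\|,$$ and $$\dim_P K^{\omega} = \overline{\dim}_B K^{\omega} = \limsup_{n \to \infty} \frac{\log |\Sigma_n^{\omega}|}{n \log b}=\limsup_{n\to\infty}\frac{1}{n \log b}\log\|A_{\omega^0}A_{\omega^1}\cdots A_{\omega^{n-1}}\|.$$
   Context: $\mathbb{N}=\{1,2,\ldots\}$, $\mathbb{N}_0=\mathbb{N}\cup\{0\}$, $D_b=\{0,1,\ldots,b-1\}$; $D_b^n$ is the set of words of length $n$ over $D_b$, and $D_b^{\mathbb{N}}$ the set of infinite sequences $(d_i)_{i=1}^\infty$ over $D_b$. $(D_b^m)^{\mathbb{N}_0}$ is the set of infinite sequences $\omega=\omega^0\omega^1\ldots$ with each $\omega^k\in D_b^m$ (superscripts are indices). For such $\omega$ define $\Sigma^\omega=\{(d_i)_{i=1}^\infty\in D_b^{\mathbb{N}}: d_{k+1}d_{k+2}\ldots d_{k+m}\ne\omega^k\ \forall k\in\mathbb{N}_0\}$, $\Sigma_k^\omega=\{d_1\ldots d_k:(d_i)_{i=1}^\infty\in\Sigma^\omega\}$ for $k\in\mathbb{N}$, and $K^\omega=\{\sum_{i=1}^\infty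 d_ib^{-i}:(d_i)_{i=1}^\infty\in\Sigma^\omega\}\subset[0,1]$. For $\mathbf{d}\in D_b^m$, $A_{\mathbf{d}}$ is the $b^{m-1}\times b^{m-1}$ adjacency $0$-$1$ matrix of the directed graph with vertex set $D_b^{m-1}$ in which there is an edge from $u_1\ldots u_{m-1}$ to $v_1\ldots v_{m-1}$ if and only if $u_2\ldots u_{m-1}=v_1\ldots v_{m-2}$ and $u_1\ldots u_{m-1}v_{m-1}\ne\mathbf{d}$. For a real matrix $A=(a_{i,j})$, $\|A\|=\sum_{i,j}|a_{i,j}|$. $|F|$ is the cardinality of a finite set $F$. $\dim_H,\dim_P,\underline{\dim}_B,\overline{\dim}_B$ denote Hausdorff, packing, lower box and upper box dimension. *)

theory Defs
  imports "HOL-Analysis.Analysis" "Jordan_Normal_Form.Matrix"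
begin

section \<open>Fractal dimensions\<close>

text \<open>
  The quantity \<open>|U|^s\<close> in the definition of Hausdorff measure, with the convention
  \<open>0^0 = 1\<close> for nonempty sets (note that \<open>0 powr 0 = 0\<close> in the library) and value \<open>0\<close> for the
  empty set. It is only used for bounded \<open>U\<close>, since \<^const>\<open>diameter\<close> is unspecified on
  unbounded sets.
\<close>

definition diam_powr :: "real \<Rightarrow> 'a::metric_space set \<Rightarrow> real" where
  "diam_powr s U = (if U = {} then 0 else if s = 0 then 1 else diameter U powr s)"

definition hausdorff_premeasure :: "real \<Rightarrow> real \<Rightarrow> 'a::metric_space set \<Rightarrow> ennreal" where
  "hausdorff_premeasure s \<delta> E =
     (INF U \<in> {U :: nat \<Rightarrow> 'a set. E \<subseteq> (\<Union>i. U i) \<and> (\<forall>i. bounded (U i) \<and> diameter (U i) \<le> \<delta>)}.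
        \<Sum>i. ennreal (diam_powr s (U i)))"

definition hausdorff_measure :: "real \<Rightarrow> 'a::metric_space set \<Rightarrow> ennreal" where
  "hausdorff_measure s E = (SUP \<delta>\<in>{0<..}. hausdorff_premeasure s \<delta> E)"

definition hausdorff_dim :: "'a::metric_space set \<Rightarrow> ereal" where
  "hausdorff_dim E = Inf {ereal s | s. 0 \<le> s \<and> hausdorff_measure s E = 0}"

text \<open>
  A \<open>\<delta>\<close>-packing of \<open>E\<close> is a countable family of pairwise disjoint closed balls with centres in
  \<open>E\<close> and radii at most \<open>\<delta>\<close>, given by its (centre, radius) pairs. The ball with radius \<open>r\<close>
  contributes \<open>(2r)^s\<close>, which on the real line (and in Euclidean spaces) is its diameter to
  the power \<open>s\<close>.
\<close>

definition packings :: "real \<Rightarrow> 'a::metric_space set \<Rightarrow> ('a \<times> real) set set" where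
  "packings \<delta> E =
     {\<B>. countable \<B> \<and> (\<forall>(x, r) \<in> \<B>. x \<in> E \<and> 0 < r \<and> r \<le> \<delta>)
          \<and> disjoint_family_on (\<lambda>(x, r). cball x r) \<B>}"

definition packing_premeasure :: "real \<Rightarrow> 'a::metric_space set \<Rightarrow> ennreal" where
  "packing_premeasure s E =
     (INF \<delta>\<in>{0<..}. SUP \<B>\<in>packings \<delta> E. \<Sum>\<^sub>\<infinity>(x, r)\<in>\<B>. ennreal ((2 * r) powr s))"

definition packing_measure :: "real \<Rightarrow> 'a::metric_space set \<Rightarrow> ennreal" where
  "packing_measure s E =
     (INF U \<in> {U :: nat \<Rightarrow> 'a set. E \<subseteq> (\<Union>i. U i)}. \<Sum>i. packing_premeasure s (U i))"

definition packing_dim :: "'a::metric_space set \<Rightarrow> ereal" where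
  "packing_dim E = Inf {ereal s | s. 0 \<le> s \<and> packing_measure s E = 0}"

text \<open>
  Smallest number of sets of diameter at most \<open>\<delta>\<close> covering \<open>E\<close>. As usual, box dimensions
  are meaningful only for nonempty totally bounded \<open>E\<close>, where finite covers exist.
\<close>

definition box_covering_number :: "real \<Rightarrow> 'a::metric_space set \<Rightarrow> nat" where
  "box_covering_number \<delta> E =
     Inf (card ` {\<C>. finite \<C> \<and> E \<subseteq> \<Union>\<C> \<and> (\<forall>U\<in>\<C>. bounded U \<and> diameter U \<le> \<delta>)})"

definition lower_box_dim :: "'a::metric_space set \<Rightarrow> ereal" where
  "lower_box_dim E =
     Liminf (at_right 0) (\<lambda>\<delta>. ereal (ln (real (box_covering_number \<delta> E)) / (- ln \<delta>)))"

definition upper_box_dim :: "'a::metric_space set \<Rightarrow> ereal" where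
  "upper_box_dim E =
     Limsup (at_right 0) (\<lambda>\<delta>. ereal (ln (real (box_covering_number \<delta> E)) / (- ln \<delta>)))"

section \<open>Digit sequences avoiding position-dependent words\<close>

definition words :: "nat \<Rightarrow> nat \<Rightarrow> nat list set" where
  "words b n = {w. length w = n \<and> set w \<subseteq> {..<b}}"

text \<open>
  Digit sequences are indexed from \<open>0\<close>: \<open>d i\<close> is the digit usually written \<open>d_{i+1}\<close>, so
  \<open>map d [k..<k + m]\<close> is the word \<open>d_{k+1} \<dots> d_{k+m}\<close>.
\<close>

definition avoiding_seqs :: "nat \<Rightarrow> nat \<Rightarrow> (nat \<Rightarrow> nat list) \<Rightarrow> (nat \<Rightarrow> nat) set" where
  "avoiding_seqs b m \<omega> = {d. (\<forall>i. d i < b) \<and> (\<forall>k. map d [k..<k + m] \<noteq> \<omega> k)}"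

definition avoiding_prefixes :: "nat \<Rightarrow> nat \<Rightarrow> (nat \<Rightarrow> nat list) \<Rightarrow> nat \<Rightarrow> nat list set" where
  "avoiding_prefixes b m \<omega> n = (\<lambda>d. map d [0..<n]) ` avoiding_seqs b m \<omega>"

definition avoiding_reals :: "nat \<Rightarrow> nat \<Rightarrow> (nat \<Rightarrow> nat list) \<Rightarrow> real set" where
  "avoiding_reals b m \<omega> = (\<lambda>d. \<Sum>i. real (d i) / real b ^ (i + 1)) ` avoiding_seqs b m \<omega>"

definition adj_edge :: "nat list \<Rightarrow> nat list \<Rightarrow> nat list \<Rightarrow> bool" where
  "adj_edge d u v \<longleftrightarrow> tl u = butlast v \<and> u @ [last v] \<noteq> d"

text \<open>
  The vertex set \<open>words b (m - 1)\<close> is enumerated without repetition by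
  \<open>List.n_lists (m - 1) [0..<b]\<close>; the order is irrelevant for norms of products.
\<close>

definition adj_mat :: "nat \<Rightarrow> nat \<Rightarrow> nat list \<Rightarrow> real Matrix.mat" where
  "adj_mat b m d =
     (let vs = List.n_lists (m - 1) [0..<b] in
      Matrix.mat (b ^ (m - 1)) (b ^ (m - 1))
        (\<lambda>(i, j). if adj_edge d (vs ! i) (vs ! j) then 1 else 0))"

primrec adj_mat_prod :: "nat \<Rightarrow> nat \<Rightarrow> (nat \<Rightarrow> nat list) \<Rightarrow> nat \<Rightarrow> real Matrix.mat" where
  "adj_mat_prod b m \<omega> 0 = 1\<^sub>m (b ^ (m - 1))"
| "adj_mat_prod b m \<omega> (Suc n) = adj_mat_prod b m \<omega> n * adj_mat b m (\<omega> n)"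

definition entry_norm :: "real Matrix.mat \<Rightarrow> real" where
  "entry_norm A = (\<Sum>i<dim_row A. \<Sum>j<dim_col A. \<bar>A $$ (i, j)\<bar>)"

lemma n_lists_enumerates_words:
  "set (List.n_lists n [0..<b]) = words b n"
  "distinct (List.n_lists n [0..<b])"
  "length (List.n_lists n [0..<b]) = b ^ n"
  by (auto simp: set_n_lists words_def distinct_n_lists length_n_lists)

end

theory Submission
  imports Defs
begin

text \<open>
  Since \<open>b \<ge> 3\<close>, any admissible word can be continued so as to end in any prescribed word of
  length \<open>m - 1\<close>, with \<open>m - 1\<close> suitable digits in between. As the further continuations
  depend on the last \<open>m - 1\<close> digits only, all admissible words of length \<open>n\<close> have, up to the
  factor \<open>C = b^(2(m-1))\<close>, the same number of extensions of any given length. Writing \<open>N n\<close>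
  for the number of admissible words of length \<open>n\<close>, the set is thus homogeneous: every
  cylinder of level \<open>n\<close> contains between \<open>N (n + k) / (C * N n)\<close> and \<open>C * N (n + k) / N n\<close>
  cylinders of level \<open>n + k\<close>. If finitely many cylinders of levels \<open>n i\<close> cover the set, counting
  subcylinders at a deep level gives \<open>1 \<le> C * (\<Sum>i. 1 / N (n i))\<close>, which bounds the Hausdorff
  dimension from below without constructing a measure. Similarly, a direct Baire category
  construction bounds the packing dimension from below. The entries of the matrix product count
  admissible words of length \<open>n + m - 1\<close> by their first and last \<open>m - 1\<close> digits.
\<close>

section \<open>Admissible words\<close>

text \<open>The forbidden word changes with the position, so in general the set has no shift
  invariance and no transition matrix common to all steps. What survives is locality: a window sees
  only \<open>m\<close> consecutive digits, hence a block of \<open>m - 1\<close> digits hides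
  everything before it from everything after it. The second obstacle is that the coding of numbers
  by digits is neither injective nor bi-Lipschitz: numbers on both sides of a \<open>b\<close>-adic
  rational may be close and yet share few digits. Prefixes are therefore compared as integers
  \<open>word_value b w\<close>. A set of diameter at most \<open>b^-n\<close> meets at most five of
  them at level \<open>n\<close>, and a quarter of any family of prefixes can be represented by well
  separated numbers. Such constants, like \<open>C\<close>, disappear in the logarithms. Lower and
  upper growth rate differ by a quantifier: an economical cover needs a single deep level, whereas
  the balls of a packing have many radii and need a bound at all deep levels. For the lower bounds
  the roles are exchanged.\<close>

lemma words_finite [simp]: "finite (words b n)"
  using finite_lists_length_eq[of "{..<b}" n] by (simp add: words_def conj_commute)

lemma card_words: "card (words b n) = b ^ n"
  using card_lists_length_eq[of "{..<b}" n] by (simp add: words_def conj_commute)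

lemma map_upt_prefix: "k \<le> n \<Longrightarrow> take k (map f [0..<n]) = map f [0..<k]"
  by (simp add: take_map)

lemma window_of_prefix: "k + m \<le> n \<Longrightarrow> take m (drop k (map d [0..<n])) = map d [k..<k + m]"
  by (simp add: take_map drop_map)

lemma limit_of_words:
  assumes ext: "\<And>i. \<exists>x. w (Suc i) = w i @ x"
    and len: "\<And>i. i \<le> length (w i)"
  obtains d where "\<And>i. map d [0..<length (w i)] = w i"
proof
  have ext': "\<exists>x. w (i + k) = w i @ x" for i k
  proof (induction k)
    case (Suc k)
    then show ?case using ext[of "i + k"] by auto
  qed simp
  \<comment> \<open>By \<open>len\<close> the word \<open>w (Suc j)\<close> has more than
    \<open>j\<close> letters, so the index is in range; nestedness gives the same letter in every
    \<open>w i\<close> that reaches position \<open>j\<close>.\<close>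
  define d where "d j = w (Suc j) ! j" for j
  have "d j = w i ! j" if "j < length (w i)" for i j
  proof -
    have l: "j < length (w (Suc j))" using len[of "Suc j"] by simp
    show ?thesis
    proof (cases "i \<le> Suc j")
      case True
      then obtain x where "w (Suc j) = w i @ x" using ext'[of i "Suc j - i"] by auto
      then show ?thesis using that by (simp add: d_def nth_append)
    next
      case False
      then obtain x where "w i = w (Suc j) @ x" using ext'[of "Suc j" "i - Suc j"] by auto
      then show ?thesis using l by (simp add: d_def nth_append)
    qed
  qed
  then show "map d [0..<length (w i)] = w i" for i
    by (intro nth_equalityI) auto
qed

locale digit_avoidance =
  fixes b m :: nat and \<omega> :: "nat \<Rightarrow> nat list"
  assumes b_ge: "3 \<le> b" and m_ge: "2 \<le> m"
begin

text \<open>Only windows inside the word are tested, which is a finite condition and a priori weaker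
  than being a prefix of an avoiding sequence; \<open>avoiding_prefixes_eq\<close> shows that the
  two agree.\<close>

definition admissible :: "nat \<Rightarrow> nat list set" where
  "admissible n = {w \<in> words b n. \<forall>k. k + m \<le> n \<longrightarrow> take m (drop k w) \<noteq> \<omega> k}"

text \<open>Suffixes are collected rather than whole words, so that the continuations of different
  words of equal length can be compared.\<close>

definition extensions :: "nat list \<Rightarrow> nat \<Rightarrow> nat list set" where
  "extensions w k = {x \<in> words b k. w @ x \<in> admissible (length w + k)}"

lemma admissible_finite [simp]: "finite (admissible n)"
  by (simp add: admissible_def)

lemma extensions_finite [simp]: "finite (extensions w k)"
  by (simp add: extensions_def)

lemma admissible_length: "w \<in> admissible n \<Longrightarrow> length w = n"
  by (simp add: admissible_def words_def)

lemma admissible_short: "n < m \<Longrightarrow> admissible n = words b n"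
  by (auto simp: admissible_def)

lemma admissible_prefix:
  assumes "u @ v \<in> admissible n" shows "u \<in> admissible (length u)"
proof -
  have "take m (drop k u) \<noteq> \<omega> k" if "k + m \<le> length u" for k
  proof -
    have "take m (drop k (u @ v)) = take m (drop k u)" using that by simp
    moreover have "k + m \<le> n" using that assms by (auto simp: admissible_def words_def)
    ultimately show ?thesis using assms unfolding admissible_def by fastforce
  qed
  with assms show ?thesis by (auto simp: admissible_def words_def)
qed

text \<open>A new letter completes a single window, the one starting at \<open>Suc n - m\<close>.
  The guard \<open>m \<le> Suc n\<close> excludes the truncated difference while the word is still
  shorter than a window.\<close>

lemma admissible_snoc:
  "w @ [a] \<in> admissible (Suc n) \<longleftrightarrow>
    w \<in> admissible n \<and> a < b \<and> (m \<le> Suc n \<longrightarrow> drop (Suc n - m) (w @ [a]) \<noteq> \<omega> (Suc n - m))"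
  (is "?L \<longleftrightarrow> ?R")
proof (cases "length w = n")
  case True
  have old: "take m (drop k (w @ [a])) = take m (drop k w)" if "k + m \<le> n" for k
    using that True by simp
  have new: "take m (drop (Suc n - m) (w @ [a])) = drop (Suc n - m) (w @ [a])" if "m \<le> Suc n"
    using that True by simp
  have split: "k + m \<le> Suc n \<longleftrightarrow> k + m \<le> n \<or> (m \<le> Suc n \<and> k = Suc n - m)" for k by auto
  show ?thesis
    unfolding admissible_def split using old new True by (auto simp: words_def)
next
  case False
  then show ?thesis by (auto simp: admissible_def words_def)
qed

text \<open>Only its last letter can complete a forbidden word. Of three digits one therefore
  remains even after a further digit \<open>c\<close> is excluded; this spare choice is what makes
  connecting words possible.\<close>

lemma admissible_extend:
  assumes "w \<in> admissible n"
  obtains a where "a < b" "a \<noteq> c" "w @ [a] \<in> admissible (Suc n)"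
proof -
  have "card ({..<b} - {c, last (\<omega> (Suc n - m))}) \<ge> b - card {c, last (\<omega> (Suc n - m))}"
    using diff_card_le_card_Diff[of "{c, last (\<omega> (Suc n - m))}" "{..<b}"] by simp
  moreover have "card {c, last (\<omega> (Suc n - m))} \<le> 2" by (simp add: card_insert_if)
  ultimately have "card ({..<b} - {c, last (\<omega> (Suc n - m))}) > 0" using b_ge by linarith
  then obtain a where a: "a < b" "a \<noteq> c" "a \<noteq> last (\<omega> (Suc n - m))"
    by (fastforce simp: card_gt_0_iff)
  have "w @ [a] \<in> admissible (Suc n)"
    unfolding admissible_snoc using assms a admissible_length[OF assms] m_ge
    by (auto dest!: arg_cong[where f = last])
  then show ?thesis using a that by blast
qed

lemma extensions_nonempty:
  assumes "w \<in> admissible n" shows "extensions w k \<noteq> {}"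
proof (induction k)
  case 0
  then show ?case using assms admissible_length[OF assms]
    by (auto simp: extensions_def words_def)
next
  case (Suc k)
  then obtain x where x: "x \<in> words b k" "w @ x \<in> admissible (length w + k)"
    by (auto simp: extensions_def)
  obtain a where "a < b" "(w @ x) @ [a] \<in> admissible (Suc (length w + k))"
    using admissible_extend[OF x(2)] by blast
  then have "x @ [a] \<in> extensions w (Suc k)"
    using x by (auto simp: extensions_def words_def)
  then show ?case by blast
qed

section \<open>Infinite sequences and their prefixes\<close>

lemma avoiding_seqs_iff: "d \<in> avoiding_seqs b m \<omega> \<longleftrightarrow> (\<forall>n. map d [0..<n] \<in> admissible n)"
proof
  assume "d \<in> avoiding_seqs b m \<omega>"
  then show "\<forall>n. map d [0..<n] \<in> admissible n"
    by (auto simp: avoiding_seqs_def admissible_def words_def window_of_prefix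
        simp del: drop_map)
next
  assume A: "\<forall>n. map d [0..<n] \<in> admissible n"
  have "d i < b" for i using A[rule_format, of "Suc i"] by (auto simp: admissible_def words_def)
  moreover have "map d [k..<k + m] \<noteq> \<omega> k" for k
  proof -
    have "take m (drop k (map d [0..<k + m])) \<noteq> \<omega> k"
      using A[rule_format, of "k + m"] unfolding admissible_def by blast
    then show ?thesis using window_of_prefix[of k m "k + m" d] by simp
  qed
  ultimately show "d \<in> avoiding_seqs b m \<omega>" by (auto simp: avoiding_seqs_def)
qed

text \<open>Every finite prefix of the limit is a prefix of some \<open>w i\<close>, and
  admissibility passes to prefixes. This is the completeness on which both the compactness and the
  category argument rest.\<close>

lemma avoiding_seqs_limit:
  assumes ext: "\<And>i. \<exists>x. w (Suc i) = w i @ x"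
    and len: "\<And>i. i \<le> length (w i)"
    and adm: "\<And>i. w i \<in> admissible (length (w i))"
  obtains d where "d \<in> avoiding_seqs b m \<omega>" "\<And>i. map d [0..<length (w i)] = w i"
proof -
  obtain d where d: "\<And>i. map d [0..<length (w i)] = w i"
    using limit_of_words[of w] ext len by blast
  have "map d [0..<n] \<in> admissible n" for n
  proof -
    have "w n = map d [0..<n] @ drop n (w n)"
      using d[of n] map_upt_prefix[OF len, of n d] by (metis append_take_drop_id)
    then have "map d [0..<n] \<in> admissible (length (map d [0..<n]))"
      using adm[of n] admissible_prefix by metis
    then show ?thesis by simp
  qed
  then show ?thesis using that d avoiding_seqs_iff by blast
qed

text \<open>There are no dead ends: an admissible word can be prolonged letter by letter forever,
  and the limit is an avoiding sequence.\<close>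

lemma avoiding_prefixes_eq: "avoiding_prefixes b m \<omega> n = admissible n"
proof
  show "avoiding_prefixes b m \<omega> n \<subseteq> admissible n"
    by (auto simp: avoiding_prefixes_def avoiding_seqs_iff)
next
  show "admissible n \<subseteq> avoiding_prefixes b m \<omega> n"
  proof
    fix w assume w: "w \<in> admissible n"
    have "\<exists>f. \<forall>i. (f i \<in> admissible (n + i) \<and> take n (f i) = w) \<and> (\<exists>x. f (Suc i) = f i @ x)"
    proof (rule dependent_nat_choice)
      show "\<exists>x. x \<in> admissible (n + 0) \<and> take n x = w"
        using w admissible_length[OF w] by auto
    next
      fix x i assume x: "x \<in> admissible (n + i) \<and> take n x = w"
      obtain a where "x @ [a] \<in> admissible (Suc (n + i))"
        using admissible_extend x by blast
      then show "\<exists>y. (y \<in> admissible (n + Suc i) \<and> take n y = w) \<and> (\<exists>z. y = x @ z)"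
        using x admissible_length[of x "n + i"] by (intro exI[of _ "x @ [a]"]) auto
    qed
    then obtain f where f: "\<And>i. f i \<in> admissible (n + i)" "\<And>i. take n (f i) = w"
      "\<And>i. \<exists>x. f (Suc i) = f i @ x" by blast
    have l: "length (f i) = n + i" for i using f(1) admissible_length by blast
    obtain d where d: "d \<in> avoiding_seqs b m \<omega>" "\<And>i. map d [0..<length (f i)] = f i"
      using avoiding_seqs_limit[of f] f l by (metis le_add2)
    have "map d [0..<n] = w" using d(2)[of 0] f(2)[of 0] l[of 0] by simp
    then show "w \<in> avoiding_prefixes b m \<omega> n" using d by (auto simp: avoiding_prefixes_def)
  qed
qed

text \<open>
  A window that ends inside \<open>v\<close> starts inside \<open>p\<close>, so it suffices that every letter of \<open>p\<close>
  differs from the first letter of the word forbidden there. Together with the letter that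
  would complete a forbidden word, this rules out two digits at each step: here \<open>b \<ge> 3\<close> is used.
\<close>

lemma admissible_connect:
  assumes w: "w \<in> admissible n" and v: "v \<in> words b (m - 1)"
  obtains p where "p \<in> words b (m - 1)" "w @ p @ v \<in> admissible (n + 2 * (m - 1))"
proof -
  have lw: "length w = n" using w by (rule admissible_length)
  have "\<exists>p. p \<in> words b j \<and> w @ p \<in> admissible (n + j) \<and> (\<forall>i<j. p ! i \<noteq> hd (\<omega> (n + i)))" for j
  proof (induction j)
    case 0
    then show ?case using w by (auto simp: words_def)
  next
    case (Suc j)
    then obtain p where p: "p \<in> words b j" "w @ p \<in> admissible (n + j)"
      "\<forall>i<j. p ! i \<noteq> hd (\<omega> (n + i))" by blast
    obtain a where a: "a < b" "a \<noteq> hd (\<omega> (n + j))" "(w @ p) @ [a] \<in> admissible (Suc (n + j))"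
      using admissible_extend[OF p(2)] by blast
    show ?case
      by (rule exI[of _ "p @ [a]"]) (use p a in \<open>auto simp: words_def nth_append less_Suc_eq\<close>)
  qed
  then obtain p where p: "p \<in> words b (m - 1)" "w @ p \<in> admissible (n + (m - 1))"
    "\<And>i. i < m - 1 \<Longrightarrow> p ! i \<noteq> hd (\<omega> (n + i))" by blast
  have lp: "length p = m - 1" and lv: "length v = m - 1" using p v by (auto simp: words_def)
  have "take m (drop k (w @ p @ v)) \<noteq> \<omega> k" if k: "k + m \<le> n + 2 * (m - 1)" for k
  proof (cases "k + m \<le> n + (m - 1)")
    case True
    then have "take m (drop k (w @ p @ v)) = take m (drop k (w @ p))" using lw lp by simp
    then show ?thesis using p(2) True by (auto simp: admissible_def)
  next
    case False
    then have i: "k - n < m - 1" "n + (k - n) = k" using k by auto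
    then have "drop k (w @ p @ v) = drop (k - n) p @ v" using lw lp by simp
    then have "hd (take m (drop k (w @ p @ v))) = p ! (k - n)"
      using i lp m_ge by (simp add: hd_take hd_append hd_drop_conv_nth)
    then show ?thesis using p(3)[OF i(1)] i(2) by metis
  qed
  then have "w @ p @ v \<in> admissible (n + 2 * (m - 1))"
    using w v p by (auto simp: admissible_def words_def)
  then show ?thesis using p that by blast
qed

section \<open>Homogeneity of the extension counts\<close>

text \<open>A window that ends beyond the block \<open>v\<close> starts inside or after
  \<open>v\<close>, since \<open>v\<close> has at least \<open>m - 1\<close> letters. The left parts
  have equal length because the forbidden word depends on the position.\<close>

lemma admissible_glue:
  assumes "u @ v \<in> admissible (l + length v)" "u' @ v @ q \<in> admissible n"
    and "length u = l" "length u' = l" "m - 1 \<le> length v"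
  shows "u @ v @ q \<in> admissible n"
proof -
  have "take m (drop k (u @ v @ q)) \<noteq> \<omega> k" if k: "k + m \<le> n" for k
  proof (cases "k + m \<le> l + length v")
    case True
    then have "take m (drop k (u @ v @ q)) = take m (drop k (u @ v))" using assms by simp
    then show ?thesis using assms(1) True by (auto simp: admissible_def)
  next
    case False
    then have "l \<le> k" using assms(5) by linarith
    then have "drop k (u @ v @ q) = drop k (u' @ v @ q)" using assms(3,4) by simp
    then show ?thesis using assms(2) k by (auto simp: admissible_def)
  qed
  then show ?thesis using assms by (auto simp: admissible_def words_def)
qed

text \<open>An extension of \<open>w\<close> becomes one of \<open>w'\<close> when its first
  \<open>m - 1\<close> letters are exchanged for a connector to the following \<open>m - 1\<close>.
  Recording the exchanged letters makes this injective and costs a factor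
  \<open>b ^ (m - 1)\<close>. The exponent \<open>2 * (m - 1)\<close> comes from short extensions,
  which have no room for a connector and are bounded trivially.\<close>

lemma card_extensions_comparable:
  assumes w: "w \<in> admissible n" and w': "w' \<in> admissible n"
  shows "card (extensions w k) \<le> b ^ (2 * (m - 1)) * card (extensions w' k)"
proof -
  let ?M = "m - 1"
  have l: "length w = n" "length w' = n" using w w' admissible_length by auto
  have pos: "card (extensions w' k) \<ge> 1"
    using extensions_nonempty[OF w'] by (simp add: Suc_le_eq card_gt_0_iff)
  show ?thesis
  proof (cases "k < 2 * ?M")
    case True
    have "card (extensions w k) \<le> card (words b k)"
      by (intro card_mono) (auto simp: extensions_def)
    also have "\<dots> = b ^ k" by (rule card_words)
    also have "\<dots> \<le> b ^ (2 * ?M)" using True b_ge by (intro power_increasing) auto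
    also have "\<dots> \<le> b ^ (2 * ?M) * card (extensions w' k)" using pos by simp
    finally show ?thesis .
  next
    case False
    define P where "P v = (SOME p. p \<in> words b ?M \<and> w' @ p @ v \<in> admissible (n + 2 * ?M))" for v
    have P: "P v \<in> words b ?M \<and> w' @ P v @ v \<in> admissible (n + 2 * ?M)" if "v \<in> words b ?M" for v
      unfolding P_def by (rule someI_ex) (metis admissible_connect[OF w' that])
    define f where "f x = (take ?M x, P (take ?M (drop ?M x)) @ drop ?M x)" for x
    have f: "f x \<in> words b ?M \<times> extensions w' k \<and> x = fst (f x) @ drop ?M (snd (f x))"
      if x: "x \<in> extensions w k" for x
    proof -
      define p v q where "p = take ?M x" and "v = take ?M (drop ?M x)" and "q = drop (2 * ?M) x"
      have xk: "x \<in> words b k" "w @ x \<in> admissible (n + k)" using x l by (auto simp: extensions_def)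
      have eq: "x = p @ v @ q" "drop ?M x = v @ q" unfolding p_def v_def q_def
        by (metis add.commute append_take_drop_id drop_drop mult_2)+
      have lx: "length x = k" using xk by (simp add: words_def)
      have lpv: "length p = ?M" "length v = ?M" using lx False unfolding p_def v_def by auto
      have pv: "p \<in> words b ?M" "v \<in> words b ?M" "set q \<subseteq> {..<b}"
        using xk(1) lpv eq(1) by (auto simp: words_def)
      note Pv = P[OF pv(2)]
      \<comment> \<open>Both left parts, \<open>w' @ P v\<close> and \<open>w @ p\<close>, have
        length \<open>n + (m - 1)\<close>, so the tail \<open>q\<close> behind the common block
        \<open>v\<close> meets the same forbidden words.\<close>
      have "(w' @ P v) @ v @ q \<in> admissible (n + k)"
        by (rule admissible_glue[where u' = "w @ p" and l = "n + ?M"])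
          (use Pv xk(2) eq(1) l lpv in \<open>auto simp: words_def mult_2 add.assoc\<close>)
      then have "P v @ v @ q \<in> extensions w' k"
        using Pv pv l lx eq(1) lpv by (auto simp: extensions_def words_def)
      moreover have "f x = (p, P v @ v @ q)" using eq(2) by (simp add: f_def p_def v_def)
      moreover have "length (P v) = ?M" using Pv by (simp add: words_def)
      ultimately show ?thesis using pv eq by auto
    qed
    have "inj_on f (extensions w k)" by (rule inj_onI) (metis f)
    moreover have "f ` extensions w k \<subseteq> words b ?M \<times> extensions w' k" using f by blast
    ultimately have "card (extensions w k) \<le> card (words b ?M \<times> extensions w' k)"
      by (rule card_inj_on_le) simp
    also have "\<dots> = b ^ ?M * card (extensions w' k)" by (simp add: card_cartesian_product card_words)
    also have "\<dots> \<le> b ^ (2 * ?M) * card (extensions w' k)"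
      using b_ge by (intro mult_right_mono power_increasing) auto
    finally show ?thesis .
  qed
qed

lemma card_extending:
  assumes "w \<in> admissible n"
  shows "card {u \<in> admissible (n + k). take n u = w} = card (extensions w k)"
proof -
  have l: "length w = n" using assms by (rule admissible_length)
  have "{u \<in> admissible (n + k). take n u = w} = (@) w ` extensions w k"
  proof (intro equalityI subsetI)
    fix u assume "u \<in> {u \<in> admissible (n + k). take n u = w}"
    then have u: "u \<in> admissible (n + k)" "w @ drop n u = u"
      using append_take_drop_id[of n u] by auto
    then have "drop n u \<in> words b k"
      by (auto simp: words_def admissible_def dest: in_set_dropD)
    then have "drop n u \<in> extensions w k" using l u by (simp add: extensions_def)
    then show "u \<in> (@) w ` extensions w k" using u(2) by (metis imageI)
  qed (use l in \<open>auto simp: extensions_def\<close>)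
  then show ?thesis by (simp add: card_image inj_on_def)
qed

lemma card_admissible_add: "card (admissible (n + k)) = (\<Sum>w\<in>admissible n. card (extensions w k))"
proof -
  have "admissible (n + k) = (\<Union>w\<in>admissible n. {u \<in> admissible (n + k). take n u = w})"
  proof (intro equalityI subsetI)
    fix u assume u: "u \<in> admissible (n + k)"
    then have "take n u \<in> admissible n"
      using admissible_prefix[of "take n u" "drop n u"] admissible_length[OF u] by simp
    then show "u \<in> (\<Union>w\<in>admissible n. {u \<in> admissible (n + k). take n u = w})" using u by blast
  qed auto
  also have "card \<dots> = (\<Sum>w\<in>admissible n. card {u \<in> admissible (n + k). take n u = w})"
    by (intro card_UN_disjoint) auto
  finally show ?thesis using card_extending by simp
qed

text \<open>The extension counts of level \<open>n\<close> add up to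
  \<open>card (admissible (n + k))\<close>, so by comparability each of them is close to their
  average.\<close>

lemma card_extensions_upper:
  assumes "w \<in> admissible n"
  shows "card (admissible n) * card (extensions w k) \<le> b ^ (2 * (m - 1)) * card (admissible (n + k))"
proof -
  have "card (admissible n) * card (extensions w k) = (\<Sum>u\<in>admissible n. card (extensions w k))"
    by simp
  also have "\<dots> \<le> (\<Sum>u\<in>admissible n. b ^ (2 * (m - 1)) * card (extensions u k))"
    using card_extensions_comparable assms by (intro sum_mono) auto
  finally show ?thesis by (simp add: card_admissible_add sum_distrib_left)
qed

lemma card_extensions_lower:
  assumes "w \<in> admissible n"
  shows "card (admissible (n + k)) \<le> b ^ (2 * (m - 1)) * card (admissible n) * card (extensions w k)"
proof -
  have "card (admissible (n + k)) \<le> (\<Sum>u\<in>admissible n. b ^ (2 * (m - 1)) * card (extensions w k))"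
    unfolding card_admissible_add using card_extensions_comparable assms by (intro sum_mono) auto
  then show ?thesis by (simp add: algebra_simps)
qed

lemma admissible_nonempty [simp]: "admissible n \<noteq> {}"
proof -
  have "[] \<in> admissible 0" using m_ge by (auto simp: admissible_def words_def)
  from extensions_nonempty[OF this, of n] show ?thesis by (auto simp: extensions_def)
qed

lemma card_admissible_pos: "0 < card (admissible n)"
  using admissible_nonempty by (simp add: card_gt_0_iff)

lemma card_admissible_le_power: "card (admissible n) \<le> b ^ n"
  unfolding card_words[symmetric] by (intro card_mono) (auto simp: admissible_def)

lemma card_admissible_mono: "card (admissible n) \<le> card (admissible (n + k))"
proof -
  have "card (admissible n) = (\<Sum>w\<in>admissible n. 1)" by simp
  also have "\<dots> \<le> (\<Sum>w\<in>admissible n. card (extensions w k))"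
    using extensions_nonempty by (intro sum_mono) (simp add: Suc_le_eq card_gt_0_iff)
  finally show ?thesis by (simp add: card_admissible_add)
qed

text \<open>Changing the level by a bounded amount costs a bounded factor. This is used between
  consecutive scales and for the shift by \<open>m - 1\<close> in the matrix norm.\<close>

lemma card_admissible_growth: "card (admissible (n + k)) \<le> b ^ k * card (admissible n)"
proof -
  have "card (extensions w k) \<le> b ^ k" for w
    unfolding card_words[symmetric] by (intro card_mono) (auto simp: extensions_def)
  then have "card (admissible (n + k)) \<le> (\<Sum>w\<in>admissible n. b ^ k)"
    unfolding card_admissible_add by (intro sum_mono)
  then show ?thesis by (simp add: mult.commute)
qed

end

section \<open>Products of adjacency matrices\<close>

lemma sum_nth_n_lists: "(\<Sum>i<b ^ n. f (List.n_lists n [0..<b] ! i)) = (\<Sum>v\<in>words b n. f v)"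
  by (rule sum.reindex_bij_betw, rule bij_betw_nth)
    (simp_all only: n_lists_enumerates_words lessThan_atLeast0)

lemma adj_mat_prod_carrier: "adj_mat_prod b m \<omega> n \<in> carrier_mat (b ^ (m - 1)) (b ^ (m - 1))"
  by (induction n) (auto simp: adj_mat_def Let_def)

lemma adj_mat_prod_dim [simp]:
  "dim_row (adj_mat_prod b m \<omega> n) = b ^ (m - 1)" "dim_col (adj_mat_prod b m \<omega> n) = b ^ (m - 1)"
  using adj_mat_prod_carrier[of b m \<omega> n] by auto

lemma adj_mat_index:
  "i < b ^ (m - 1) \<Longrightarrow> j < b ^ (m - 1) \<Longrightarrow> adj_mat b m d $$ (i, j) =
    of_bool (adj_edge d (List.n_lists (m - 1) [0..<b] ! i) (List.n_lists (m - 1) [0..<b] ! j))"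
  by (simp add: adj_mat_def Let_def)

lemma adj_mat_dim [simp]:
  "dim_row (adj_mat b m d) = b ^ (m - 1)" "dim_col (adj_mat b m d) = b ^ (m - 1)"
  by (simp_all add: adj_mat_def Let_def)

lemma adj_mat_prod_Suc_index:
  assumes "i < b ^ (m - 1)" "j < b ^ (m - 1)"
  shows "adj_mat_prod b m \<omega> (Suc n) $$ (i, j) =
    (\<Sum>l<b ^ (m - 1). adj_mat_prod b m \<omega> n $$ (i, l) * adj_mat b m (\<omega> n) $$ (l, j))"
  using assms by (simp add: times_mat_def scalar_prod_def lessThan_atLeast0)

lemma adj_mat_prod_nonneg:
  "i < b ^ (m - 1) \<Longrightarrow> j < b ^ (m - 1) \<Longrightarrow> 0 \<le> adj_mat_prod b m \<omega> n $$ (i, j)"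
proof (induction n arbitrary: j)
  case (Suc n)
  then show ?case
    by (subst adj_mat_prod_Suc_index) (auto intro!: sum_nonneg simp: adj_mat_index)
qed (simp add: one_mat_def)

context digit_avoidance
begin

text \<open>A word of length \<open>n + (m - 1)\<close> spells a walk of \<open>n\<close> edges
  through its blocks of \<open>m - 1\<close> letters, and \<open>v\<close> is the last vertex. The
  first vertex stays free because the norm sums over it.\<close>

definition admissible_ending :: "nat \<Rightarrow> nat list \<Rightarrow> nat list set" where
  "admissible_ending n v = {w \<in> admissible (n + (m - 1)). drop n w = v}"

lemma admissible_ending_Suc:
  assumes v: "v \<in> words b (m - 1)"
  shows "card (admissible_ending (Suc n) v) =
    card {w \<in> admissible (n + (m - 1)). adj_edge (\<omega> n) (drop n w) v}"
proof -
  have lv: "length v = m - 1" and v0: "v \<noteq> []" using v m_ge by (auto simp: words_def)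
  have lb: "last v < b" using v last_in_set[OF v0] by (auto simp: words_def)
  \<comment> \<open>The letter appended to a word of length \<open>n + (m - 1)\<close> completes the
    window at position \<open>n\<close>, which is why the next factor is the matrix of
    \<open>\<omega> n\<close>.\<close>
  have n: "Suc (n + (m - 1)) - m = n" "m \<le> Suc (n + (m - 1))" using m_ge by auto
  have "admissible_ending (Suc n) v =
    (\<lambda>w. w @ [last v]) ` {w \<in> admissible (n + (m - 1)). adj_edge (\<omega> n) (drop n w) v}"
  proof (intro equalityI subsetI)
    fix u assume "u \<in> admissible_ending (Suc n) v"
    then have u: "u \<in> admissible (Suc (n + (m - 1)))" "drop (Suc n) u = v"
      by (auto simp: admissible_ending_def)
    define w where "w = butlast u"
    have lu: "length u = Suc (n + (m - 1))" using u admissible_length by blast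
    have "last u = last v" using u(2) v0 by (metis drop_eq_Nil2 last_drop not_le)
    then have uw: "u = w @ [last v]" using lu unfolding w_def by (metis append_butlast_last_id list.size(3) nat.distinct(1))
    have lw: "length w = n + (m - 1)" using lu w_def by simp
    have "v = tl (drop n w) @ [last v]"
      using u(2) lw m_ge unfolding uw by (auto simp: drop_Suc tl_drop)
    then have "tl (drop n w) = butlast v" by (metis butlast_snoc)
    moreover have "w \<in> admissible (n + (m - 1))" "drop n w @ [last v] \<noteq> \<omega> n"
      using u(1) lw unfolding uw admissible_snoc n using m_ge by auto
    ultimately show "u \<in> (\<lambda>w. w @ [last v]) ` {w \<in> admissible (n + (m - 1)). adj_edge (\<omega> n) (drop n w) v}"
      using uw by (auto simp: adj_edge_def)
  next
    fix u assume "u \<in> (\<lambda>w. w @ [last v]) ` {w \<in> admissible (n + (m - 1)). adj_edge (\<omega> n) (drop n w) v}"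
    then obtain w where w: "u = w @ [last v]" "w \<in> admissible (n + (m - 1))"
      "tl (drop n w) = butlast v" "drop n w @ [last v] \<noteq> \<omega> n" by (auto simp: adj_edge_def)
    have lw: "length w = n + (m - 1)" using w(2) admissible_length by blast
    have "u \<in> admissible (Suc (n + (m - 1)))"
      unfolding w(1) admissible_snoc n using w lb lw by auto
    moreover have "drop (Suc n) u = v"
    proof -
      have "drop (Suc n) u = tl (drop n w) @ [last v]"
        using w(1) lw m_ge by (auto simp: drop_Suc tl_drop)
      then show ?thesis using w(3) v0 by simp
    qed
    ultimately show "u \<in> admissible_ending (Suc n) v" by (simp add: admissible_ending_def)
  qed
  then show ?thesis by (simp add: card_image inj_on_def)
qed

text \<open>Multiplication from the right acts on the column sums alone, so the recursion closes
  without tracking single entries.\<close>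

lemma column_sum_adj_mat_prod:
  assumes "j < b ^ (m - 1)"
  shows "(\<Sum>i<b ^ (m - 1). adj_mat_prod b m \<omega> n $$ (i, j)) =
    real (card (admissible_ending n (List.n_lists (m - 1) [0..<b] ! j)))"
  using assms
proof (induction n arbitrary: j)
  case 0
  let ?v = "List.n_lists (m - 1) [0..<b] ! j"
  have "?v \<in> words b (m - 1)" using 0 n_lists_enumerates_words by (metis nth_mem)
  then have "admissible_ending 0 ?v = {?v}"
    using m_ge by (auto simp: admissible_ending_def admissible_short)
  then show ?case using 0 by (simp add: one_mat_def sum.delta)
next
  case (Suc n)
  let ?N = "b ^ (m - 1)" and ?vs = "List.n_lists (m - 1) [0..<b]"
  have v: "?vs ! j \<in> words b (m - 1)" using Suc.prems n_lists_enumerates_words by (metis nth_mem)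
  have "(\<Sum>i<?N. adj_mat_prod b m \<omega> (Suc n) $$ (i, j)) =
     (\<Sum>i<?N. \<Sum>l<?N. adj_mat_prod b m \<omega> n $$ (i, l) * adj_mat b m (\<omega> n) $$ (l, j))"
    by (intro sum.cong refl adj_mat_prod_Suc_index) (use Suc.prems in auto)
  also have "\<dots> = (\<Sum>l<?N. \<Sum>i<?N. adj_mat_prod b m \<omega> n $$ (i, l) * adj_mat b m (\<omega> n) $$ (l, j))"
    by (rule sum.swap)
  also have "\<dots> = (\<Sum>l<?N. real (card (admissible_ending n (?vs ! l))) * of_bool (adj_edge (\<omega> n) (?vs ! l) (?vs ! j)))"
    by (intro sum.cong refl) (use Suc in \<open>simp add: sum_distrib_right[symmetric] adj_mat_index\<close>)
  also have "\<dots> = (\<Sum>u\<in>words b (m - 1). real (card (admissible_ending n u)) * of_bool (adj_edge (\<omega> n) u (?vs ! j)))"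
    by (rule sum_nth_n_lists)
  also have "\<dots> = real (\<Sum>u\<in>words b (m - 1). card {w \<in> admissible_ending n u. adj_edge (\<omega> n) u (?vs ! j)})"
    by (simp add: of_bool_def) (intro sum.cong refl, simp)
  also have "(\<Sum>u\<in>words b (m - 1). card {w \<in> admissible_ending n u. adj_edge (\<omega> n) u (?vs ! j)}) =
     card (\<Union>u\<in>words b (m - 1). {w \<in> admissible_ending n u. adj_edge (\<omega> n) u (?vs ! j)})"
    by (subst card_UN_disjoint) (auto simp: admissible_ending_def)
  also have "(\<Union>u\<in>words b (m - 1). {w \<in> admissible_ending n u. adj_edge (\<omega> n) u (?vs ! j)}) =
     {w \<in> admissible (n + (m - 1)). adj_edge (\<omega> n) (drop n w) (?vs ! j)}"
    by (auto simp: admissible_ending_def) (auto simp: words_def admissible_def dest: in_set_dropD)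
  finally show ?case using admissible_ending_Suc[OF v] by simp
qed

theorem entry_norm_adj_mat_prod: "entry_norm (adj_mat_prod b m \<omega> n) = card (admissible (n + (m - 1)))"
proof -
  let ?N = "b ^ (m - 1)" and ?vs = "List.n_lists (m - 1) [0..<b]"
  have "entry_norm (adj_mat_prod b m \<omega> n) = (\<Sum>i<?N. \<Sum>j<?N. adj_mat_prod b m \<omega> n $$ (i, j))"
    unfolding entry_norm_def adj_mat_prod_dim
    by (intro sum.cong refl) (simp add: adj_mat_prod_nonneg)
  also have "\<dots> = (\<Sum>j<?N. \<Sum>i<?N. adj_mat_prod b m \<omega> n $$ (i, j))" by (rule sum.swap)
  also have "\<dots> = (\<Sum>j<?N. real (card (admissible_ending n (?vs ! j))))"
    by (intro sum.cong refl column_sum_adj_mat_prod) auto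
  also have "\<dots> = (\<Sum>u\<in>words b (m - 1). real (card (admissible_ending n u)))"
    by (rule sum_nth_n_lists)
  also have "\<dots> = real (card (\<Union>u\<in>words b (m - 1). admissible_ending n u))"
    by (subst card_UN_disjoint) (auto simp: admissible_ending_def)
  also have "(\<Union>u\<in>words b (m - 1). admissible_ending n u) = admissible (n + (m - 1))"
    by (auto simp: admissible_ending_def) (auto simp: words_def admissible_def dest: in_set_dropD)
  finally show ?thesis .
qed

end

section \<open>Digit expansions\<close>

text \<open>The first letter is the most significant one, so \<open>word_value b w\<close> divided
  by \<open>b ^ length w\<close> is the left end of the \<open>b\<close>-adic interval of numbers
  with prefix \<open>w\<close>.\<close>

definition word_value :: "nat \<Rightarrow> nat list \<Rightarrow> nat" where
  "word_value b w = foldl (\<lambda>a x. b * a + x) 0 w"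

lemma word_value_Nil [simp]: "word_value b [] = 0"
  and word_value_snoc [simp]: "word_value b (w @ [x]) = b * word_value b w + x"
  by (simp_all add: word_value_def)

lemma inj_on_word_value: "inj_on (word_value b) (words b n)"
proof (induction n)
  case (Suc n)
  show ?case
  proof (rule inj_onI)
    fix u v assume u: "u \<in> words b (Suc n)" and v: "v \<in> words b (Suc n)"
      and eq: "word_value b u = word_value b v"
    obtain u' x where ux: "u = u' @ [x]" using u by (cases u rule: rev_cases) (auto simp: words_def)
    obtain v' y where vy: "v = v' @ [y]" using v by (cases v rule: rev_cases) (auto simp: words_def)
    have *: "u' \<in> words b n" "v' \<in> words b n" "x < b" "y < b"
      using u v ux vy by (auto simp: words_def)
    have "b * word_value b u' + x = b * word_value b v' + y" using eq ux vy by simp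
    then have "x = y \<and> word_value b u' = word_value b v'" using *
      by (metis add.commute div_mult_self2 div_less add_0 mod_less mod_mult_self2 not_less_zero)
    then show "u = v" using Suc * ux vy by (auto dest: inj_onD)
  qed
qed (simp add: words_def inj_on_def)

definition expansion :: "nat \<Rightarrow> (nat \<Rightarrow> nat) \<Rightarrow> real" where
  "expansion b d = (\<Sum>i. real (d i) / real b ^ (i + 1))"

text \<open>This is the largest possible tail after \<open>n\<close> digits; it dominates all digit
  series.\<close>

lemma top_digits_sums:
  assumes "2 \<le> b" shows "(\<lambda>i. real (b - 1) / real b ^ (i + n + 1)) sums (1 / real b ^ n)"
proof -
  have "(\<lambda>i. (1 / real b) ^ i) sums (1 / (1 - 1 / real b))"
    using assms by (intro geometric_sums) simp
  then have "(\<lambda>i. real (b - 1) / real b ^ (n + 1) * (1 / real b) ^ i) sums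
      (real (b - 1) / real b ^ (n + 1) * (1 / (1 - 1 / real b)))"
    by (rule sums_mult)
  moreover have "real (b - 1) / real b ^ (n + 1) * (1 / (1 - 1 / real b)) = 1 / real b ^ n"
    using assms by (simp add: field_simps of_nat_diff)
  moreover have "real (b - 1) / real b ^ (n + 1) * (1 / real b) ^ i = real (b - 1) / real b ^ (i + n + 1)" for i
    by (simp add: power_divide power_add)
  ultimately show ?thesis by simp
qed

text \<open>Multiplication by \<open>b ^ n\<close> turns the first \<open>n\<close> digits into an
  integer and leaves a tail in the closed unit interval. The upper bound is attained when all later
  digits are \<open>b - 1\<close>, so neighbouring prefixes can share a point.\<close>

lemma expansion_prefix_bounds:
  assumes b: "2 \<le> b" and d: "\<And>i. d i < b"
  shows "real (word_value b (map d [0..<n])) \<le> real b ^ n * expansion b d"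
    and "real b ^ n * expansion b d \<le> real (word_value b (map d [0..<n])) + 1"
proof -
  let ?f = "\<lambda>i. real (d i) / real b ^ (i + 1)"
  have le: "?f (i + k) \<le> real (b - 1) / real b ^ (i + k + 1)" for i k
    using d[of "i + k"] b by (intro divide_right_mono) auto
  have "summable ?f"
    by (rule summable_comparison_test'[OF sums_summable[OF top_digits_sums[OF b, of 0]], of 0])
      (use le[of _ 0] in auto)
  then have split: "expansion b d = (\<Sum>i. ?f (i + n)) + (\<Sum>i<n. ?f i)"
    and sn: "summable (\<lambda>i. ?f (i + n))"
    unfolding expansion_def
    by (rule suminf_split_initial_segment, rule summable_ignore_initial_segment)
  have "real b ^ n * (\<Sum>i<n. ?f i) = real (word_value b (map d [0..<n]))"
  proof (induction n)
    case (Suc n)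
    have "real b ^ Suc n * (\<Sum>i<Suc n. ?f i) = real b * (real b ^ n * (\<Sum>i<n. ?f i)) + real (d n)"
      using b by (simp add: algebra_simps)
    then show ?case using Suc by simp
  qed simp
  moreover have "0 \<le> (\<Sum>i. ?f (i + n))" by (intro suminf_nonneg sn) simp
  moreover have "(\<Sum>i. ?f (i + n)) \<le> 1 / real b ^ n"
    unfolding sums_unique[OF top_digits_sums[OF b, of n]]
    by (intro suminf_le sn le sums_summable[OF top_digits_sums[OF b, of n]])
  then have "real b ^ n * (\<Sum>i. ?f (i + n)) \<le> 1"
    using b by (simp add: field_simps)
  ultimately show "real (word_value b (map d [0..<n])) \<le> real b ^ n * expansion b d"
    "real b ^ n * expansion b d \<le> real (word_value b (map d [0..<n])) + 1"
    unfolding split by (simp_all add: distrib_left)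
qed

lemma dist_expansion_le:
  assumes "2 \<le> b" "\<And>i. d i < b" "\<And>i. d' i < b" "map d [0..<n] = map d' [0..<n]"
  shows "\<bar>expansion b d - expansion b d'\<bar> \<le> 1 / real b ^ n"
proof -
  have "\<bar>real b ^ n * expansion b d - real b ^ n * expansion b d'\<bar> \<le> 1"
    using expansion_prefix_bounds[of b d n] expansion_prefix_bounds[of b d' n] assms
    by (simp add: abs_le_iff)
  then have "real b ^ n * \<bar>expansion b d - expansion b d'\<bar> \<le> 1"
    by (simp add: abs_mult flip: right_diff_distrib)
  then show ?thesis using assms(1) by (simp add: field_simps)
qed

lemma prefixes_in_words: "(\<And>d i. d \<in> S \<Longrightarrow> d i < b) \<Longrightarrow> (\<lambda>d. map d [0..<n]) ` S \<subseteq> words b n"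
  by (auto simp: words_def)

lemma card_prefixes_le:
  assumes b: "2 \<le> b" and S: "\<And>d i. d \<in> S \<Longrightarrow> d i < b"
    and close: "\<And>d d'. d \<in> S \<Longrightarrow> d' \<in> S \<Longrightarrow> \<bar>expansion b d - expansion b d'\<bar> \<le> 1 / real b ^ n"
  shows "card ((\<lambda>d. map d [0..<n]) ` S) \<le> 5"
proof (cases "S = {}")
  case False
  then obtain e where e: "e \<in> S" by blast
  let ?v = "\<lambda>d. word_value b (map d [0..<n])"
  \<comment> \<open>One unit comes from the distance of the points and one from the width of a
    prefix interval. Truncation of \<open>?v e - 2\<close> at zero can only remove candidates from
    the five.\<close>
  have "?v d \<in> {?v e - 2..?v e + 2}" if d: "d \<in> S" for d
  proof -
    have "real b ^ n * \<bar>expansion b d - expansion b e\<bar> \<le> 1"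
      using close[OF d e] b by (simp add: field_simps)
    then have "\<bar>real b ^ n * expansion b d - real b ^ n * expansion b e\<bar> \<le> 1"
      by (simp add: abs_mult flip: right_diff_distrib)
    then have "real (?v d) \<le> real (?v e) + 2" "real (?v e) \<le> real (?v d) + 2"
      using expansion_prefix_bounds[of b d n, OF b S[OF d]] expansion_prefix_bounds[of b e n, OF b S[OF e]]
      by linarith+
    then show ?thesis by auto
  qed
  then have "word_value b ` (\<lambda>d. map d [0..<n]) ` S \<subseteq> {?v e - 2..?v e + 2}" by blast
  then have "card (word_value b ` (\<lambda>d. map d [0..<n]) ` S) \<le> card {?v e - 2..?v e + 2}"
    by (intro card_mono) auto
  moreover have "inj_on (word_value b) ((\<lambda>d. map d [0..<n]) ` S)"
    by (rule inj_on_subset[OF inj_on_word_value prefixes_in_words]) (use S in auto)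
  ultimately show ?thesis by (simp add: card_image)
qed simp

lemma add_le_if_mod_eq:
  fixes x y k :: nat
  assumes "x mod k = y mod k" "x < y" shows "x + k \<le> y"
proof -
  have "k dvd y - x" using assms mod_eq_dvd_iff_nat[of x y k] by auto
  then have "k \<le> y - x" using assms(2) by (intro dvd_imp_le) auto
  then show ?thesis using assms(2) by linarith
qed

text \<open>Prefixes whose values agree modulo 4 differ by at least 4, which separates the points.\<close>

lemma separated_subset:
  assumes b: "2 \<le> b" and S: "\<And>d i. d \<in> S \<Longrightarrow> d i < b"
  obtains T where "T \<subseteq> S" "finite T" "card ((\<lambda>d. map d [0..<n]) ` S) \<le> 4 * card T"
    "\<And>d d'. d \<in> T \<Longrightarrow> d' \<in> T \<Longrightarrow> d \<noteq> d' \<Longrightarrow> 3 / real b ^ n \<le> \<bar>expansion b d - expansion b d'\<bar>"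
proof -
  define pre where "pre = (\<lambda>d::nat \<Rightarrow> nat. map d [0..<n])"
  define W where "W r = {w \<in> pre ` S. word_value b w mod 4 = r}" for r
  have sub: "pre ` S \<subseteq> words b n" unfolding pre_def using S by (rule prefixes_in_words)
  then have fin: "finite (pre ` S)" using finite_subset words_finite by blast
  have "\<exists>r. card (pre ` S) \<le> 4 * card (W r)"
  proof (rule ccontr)
    assume "\<not> ?thesis"
    then have lt: "4 * card (W r) < card (pre ` S)" for r by (simp add: not_le)
    have "pre ` S = (\<Union>r<4. W r)" by (auto simp: W_def)
    then have "card (pre ` S) \<le> (\<Sum>r<4. card (W r))" by (metis card_UN_le finite_lessThan)
    then show False using lt[of 0] lt[of 1] lt[of 2] lt[of 3] by (simp add: eval_nat_numeral)
  qed
  then obtain r where r: "card (pre ` S) \<le> 4 * card (W r)" by blast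
  define T where "T = inv_into S pre ` W r"
  have TS: "T \<subseteq> S" unfolding T_def W_def by (auto intro: inv_into_into)
  have pT: "pre (inv_into S pre w) = w" if "w \<in> W r" for w
    using that f_inv_into_f[of w pre S] by (simp add: W_def)
  have "card T = card (W r)"
    unfolding T_def by (rule card_image, rule inj_onI) (metis pT)
  moreover have "3 / real b ^ n \<le> \<bar>expansion b d - expansion b d'\<bar>"
    if d: "d \<in> T" "d' \<in> T" "d \<noteq> d'" for d d'
  proof -
    let ?v = "word_value b (pre d)" and ?v' = "word_value b (pre d')"
    have W: "pre d \<in> W r" "pre d' \<in> W r" and "pre d \<noteq> pre d'"
      using d pT unfolding T_def by auto
    then have "?v \<noteq> ?v'" using inj_on_word_value[of b n] sub by (auto simp: W_def dest!: inj_onD)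
    moreover have "?v mod 4 = ?v' mod 4" using W by (simp add: W_def)
    ultimately have "?v + 4 \<le> ?v' \<or> ?v' + 4 \<le> ?v"
      using add_le_if_mod_eq[of ?v 4 ?v'] add_le_if_mod_eq[of ?v' 4 ?v] by linarith
    then have "real ?v + 4 \<le> real ?v' \<or> real ?v' + 4 \<le> real ?v" by linarith
    moreover have dd: "d i < b" "d' i < b" for i using d TS S by auto
    \<comment> \<open>Values four apart leave a gap of three, as each point lies at most one unit
      above its value. Three exceeds two, so closed balls of radius \<open>1 / b ^ n\<close> around
      the points are disjoint.\<close>
    ultimately have "3 \<le> \<bar>real b ^ n * expansion b d - real b ^ n * expansion b d'\<bar>"
      using expansion_prefix_bounds[of b d n, OF b dd(1)] expansion_prefix_bounds[of b d' n, OF b dd(2)]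
      unfolding pre_def by linarith
    then have "3 \<le> real b ^ n * \<bar>expansion b d - expansion b d'\<bar>"
      by (simp add: abs_mult flip: right_diff_distrib)
    then show ?thesis using b by (simp add: field_simps)
  qed
  moreover have "finite T" unfolding T_def W_def using fin by simp
  ultimately show ?thesis using that[of T] TS r unfolding pre_def by simp
qed

section \<open>Box dimensions\<close>

lemma Liminf_filtermap:
  fixes g :: "'b \<Rightarrow> 'c :: {complete_linorder}"
  shows "Liminf (filtermap h F) g = Liminf F (\<lambda>x. g (h x))"
  by (rule antisym) (auto simp: le_Liminf_iff eventually_filtermap dest: less_LiminfD)

lemma Limsup_filtermap:
  fixes g :: "'b \<Rightarrow> 'c :: {complete_linorder}"
  shows "Limsup (filtermap h F) g = Limsup F (\<lambda>x. g (h x))"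
  by (rule antisym) (auto simp: Limsup_le_iff eventually_filtermap dest: Limsup_lessD)

lemma Liminf_le_of_tendsto_diff:
  fixes f g :: "'a \<Rightarrow> real"
  assumes "((\<lambda>x. f x - g x) \<longlongrightarrow> 0) F"
  shows "Liminf F (\<lambda>x. ereal (g x)) \<le> Liminf F (\<lambda>x. ereal (f x))"
  unfolding le_Liminf_iff
proof (intro allI impI)
  fix y assume "y < Liminf F (\<lambda>x. ereal (g x))"
  \<comment> \<open>Two intermediate values are finite even if the outer ones are not, and the gap
    between them absorbs the difference of the functions.\<close>
  then obtain z1 where z1: "y < z1" "z1 < Liminf F (\<lambda>x. ereal (g x))" using dense by blast
  then obtain z2 where z2: "z1 < z2" "z2 < Liminf F (\<lambda>x. ereal (g x))" using dense by blast
  obtain r1 where r1: "z1 = ereal r1" using z1(1) z2(1) by (cases z1) auto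
  obtain r2 where r2: "z2 = ereal r2" using z2 by (cases z2) auto
  have "\<forall>\<^sub>F x in F. z2 < ereal (g x)" using z2(2) by (rule less_LiminfD)
  moreover have "\<forall>\<^sub>F x in F. \<bar>f x - g x\<bar> < r2 - r1"
    using tendstoD[OF assms, of "r2 - r1"] z2(1) r1 r2 by (simp add: dist_real_def)
  ultimately show "\<forall>\<^sub>F x in F. y < ereal (f x)"
  proof eventually_elim
    case (elim x)
    then have "r1 < f x" using r2 by auto
    then show ?case using z1(1) r1 by (metis ereal_less(2) less_ereal.simps(1) less_trans)
  qed
qed

lemma Liminf_eq_of_tendsto_diff:
  fixes f g :: "'a \<Rightarrow> real"
  assumes "((\<lambda>x. f x - g x) \<longlongrightarrow> 0) F"
  shows "Liminf F (\<lambda>x. ereal (f x)) = Liminf F (\<lambda>x. ereal (g x))"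
proof (rule antisym)
  have "((\<lambda>x. g x - f x) \<longlongrightarrow> 0) F" using tendsto_minus[OF assms] by simp
  then show "Liminf F (\<lambda>x. ereal (f x)) \<le> Liminf F (\<lambda>x. ereal (g x))"
    by (rule Liminf_le_of_tendsto_diff)
qed (rule Liminf_le_of_tendsto_diff[OF assms])

lemma Limsup_eq_of_tendsto_diff:
  fixes f g :: "'a \<Rightarrow> real"
  assumes "((\<lambda>x. f x - g x) \<longlongrightarrow> 0) F"
  shows "Limsup F (\<lambda>x. ereal (f x)) = Limsup F (\<lambda>x. ereal (g x))"
proof -
  have "((\<lambda>x. - f x - - g x) \<longlongrightarrow> 0) F" using tendsto_minus[OF assms] by simp
  then have "Liminf F (\<lambda>x. - ereal (f x)) = Liminf F (\<lambda>x. - ereal (g x))"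
    using Liminf_eq_of_tendsto_diff[of "\<lambda>x. - f x" "\<lambda>x. - g x" F] by simp
  then show ?thesis by (simp only: ereal_Liminf_uminus ereal_uminus_eq_iff)
qed

section \<open>From real scales to integer levels\<close>

definition scale :: "nat \<Rightarrow> real \<Rightarrow> nat" where
  "scale b \<delta> = nat \<lfloor>log (real b) (1 / \<delta>)\<rfloor>"

lemma le_scale_iff:
  assumes "2 \<le> b" "0 < \<delta>" "\<delta> \<le> 1"
  shows "k \<le> scale b \<delta> \<longleftrightarrow> \<delta> \<le> 1 / real b ^ k"
proof -
  have "0 \<le> log (real b) (1 / \<delta>)" using assms by (intro zero_le_log_cancel_iff[THEN iffD2]) auto
  then have "k \<le> scale b \<delta> \<longleftrightarrow> real k \<le> log (real b) (1 / \<delta>)"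
    unfolding scale_def by (simp add: le_nat_iff le_floor_iff)
  also have "\<dots> \<longleftrightarrow> real b ^ k \<le> 1 / \<delta>" using assms by (simp add: le_log_iff powr_realpow)
  also have "\<dots> \<longleftrightarrow> \<delta> \<le> 1 / real b ^ k" using assms by (simp add: field_simps)
  finally show ?thesis .
qed

lemma scale_bounds:
  assumes "2 \<le> b" "0 < \<delta>" "\<delta> \<le> 1"
  shows "\<delta> \<le> 1 / real b ^ scale b \<delta>" "1 / real b ^ Suc (scale b \<delta>) < \<delta>"
  using le_scale_iff[OF assms, of "scale b \<delta>"] le_scale_iff[OF assms, of "Suc (scale b \<delta>)"]
  by (simp_all only: not_le[symmetric]) auto

lemma inverse_power_tendsto_0: "2 \<le> b \<Longrightarrow> (\<lambda>n. 1 / real b ^ n) \<longlonglongrightarrow> 0"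
  using LIMSEQ_inverse_realpow_zero[of "real b"] by (simp add: field_simps inverse_eq_divide)

lemma eventually_inverse_power_less: "2 \<le> b \<Longrightarrow> 0 < e \<Longrightarrow> \<forall>\<^sub>F n in sequentially. 1 / real b ^ n < e"
  by (rule order_tendstoD(2)[OF inverse_power_tendsto_0])

text \<open>Convergence of \<open>scale b\<close> to infinity alone would give only one inequality
  between the limits inferior. Equality of the filters holds because every level \<open>n\<close> is
  attained, at \<open>1 / b ^ n\<close>.\<close>

lemma filtermap_scale: 
  assumes b: "2 \<le> b" shows "filtermap (scale b) (at_right 0) = sequentially"
proof (rule antisym)
  show "filtermap (scale b) (at_right 0) \<le> sequentially"
  proof (rule filter_leI)
    fix P assume "eventually P sequentially"
    then obtain k where k: "\<And>n. k \<le> n \<Longrightarrow> P n" by (auto simp: eventually_sequentially)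
    have "P (scale b \<delta>)" if "0 < \<delta>" "\<delta> < 1 / real b ^ k" for \<delta>
    proof -
      have "1 / real b ^ k \<le> 1" using b by (simp add: field_simps)
      then show ?thesis using that le_scale_iff[OF b, of \<delta> k] k by simp
    qed
    then show "eventually P (filtermap (scale b) (at_right 0))"
      unfolding eventually_filtermap eventually_at_right_field using b
      by (intro exI[of _ "1 / real b ^ k"]) auto
  qed
  show "sequentially \<le> filtermap (scale b) (at_right 0)"
  proof (rule filter_leI)
    fix P assume "eventually P (filtermap (scale b) (at_right 0))"
    then obtain e where e: "0 < e" "\<And>\<delta>. 0 < \<delta> \<Longrightarrow> \<delta> < e \<Longrightarrow> P (scale b \<delta>)"
      unfolding eventually_filtermap eventually_at_right_field by blast
    show "eventually P sequentially"
      using eventually_inverse_power_less[OF b e(1)]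
    proof eventually_elim
      case (elim n)
      have pos: "0 < 1 / real b ^ n" "1 / real b ^ n \<le> 1" using b by (simp_all add: field_simps)
      have "k \<le> scale b (1 / real b ^ n) \<longleftrightarrow> k \<le> n" for k
        unfolding le_scale_iff[OF b pos] using b
        by (simp add: divide_le_eq_1 field_simps power_increasing_iff)
      then have "scale b (1 / real b ^ n) = n" by (meson order.antisym order.refl)
      then show ?case using e(2)[OF pos(1) elim] by simp
    qed
  qed
qed

lemma diameter_le_real:
  fixes S :: "real set"
  assumes "0 \<le> e" "\<And>x y. x \<in> S \<Longrightarrow> y \<in> S \<Longrightarrow> \<bar>x - y\<bar> \<le> e"
  shows "bounded S" "diameter S \<le> e"
proof -
  show "bounded S"
  proof (cases "S = {}")
    case False
    then obtain x where "x \<in> S" by blast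
    then show ?thesis using assms(2) unfolding bounded_def dist_real_def by blast
  qed simp
  show "diameter S \<le> e" using assms by (intro diameter_le) auto
qed

text \<open>Counts and scales are known up to bounded factors, so their logarithms carry bounded
  errors. As \<open>L t / y t\<close> lies in the unit interval, an error \<open>C\<close> in the
  denominator moves the quotient by at most \<open>C / x t\<close>.\<close>

lemma tendsto_ratio_perturb:
  fixes L B x y :: "'a \<Rightarrow> real" and C :: real
  assumes x: "filterlim x at_top F" and y: "filterlim y at_top F"
    and L: "\<forall>\<^sub>F t in F. 0 \<le> L t \<and> L t \<le> y t"
    and B: "\<forall>\<^sub>F t in F. \<bar>B t - L t\<bar> \<le> C" and xy: "\<forall>\<^sub>F t in F. \<bar>x t - y t\<bar> \<le> C"
  shows "((\<lambda>t. B t / x t - L t / y t) \<longlongrightarrow> 0) F"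
proof (rule Lim_null_comparison)
  have "\<forall>\<^sub>F t in F. 0 < x t" "\<forall>\<^sub>F t in F. 0 < y t"
    using x y by (auto simp: filterlim_at_top_dense)
  then show "\<forall>\<^sub>F t in F. norm (B t / x t - L t / y t) \<le> 2 * C / x t"
    using L B xy
  proof eventually_elim
    case (elim t)
    have "B t / x t - L t / y t = ((B t - L t) + (L t / y t) * (y t - x t)) / x t"
      using elim by (simp add: field_simps)
    moreover have "\<bar>(L t / y t) * (y t - x t)\<bar> \<le> 1 * C"
      unfolding abs_mult using elim by (intro mult_mono) auto
    then have "\<bar>(B t - L t) + (L t / y t) * (y t - x t)\<bar> \<le> 2 * C"
      using elim by linarith
    ultimately show ?case using elim by (simp add: abs_divide divide_right_mono)
  qed
  show "((\<lambda>t. 2 * C / x t) \<longlongrightarrow> 0) F"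
    by (intro real_tendsto_divide_at_top[OF tendsto_const x])
qed

context digit_avoidance
begin

section \<open>Cylinders, covers and box counting\<close>

lemma b_ge_2: "2 \<le> b" using b_ge by simp

lemma ln_b_pos: "0 < ln (real b)" using b_ge by simp

lemma avoiding_reals_eq: "avoiding_reals b m \<omega> = expansion b ` avoiding_seqs b m \<omega>"
  by (simp add: avoiding_reals_def expansion_def)

lemma avoiding_seqs_digit: "d \<in> avoiding_seqs b m \<omega> \<Longrightarrow> d i < b"
  by (simp add: avoiding_seqs_def)

text \<open>Codings are counted, not points: a number with two avoiding expansions contributes the
  prefixes of both, and no canonical expansion has to be chosen.\<close>

definition prefixes_meeting :: "real set \<Rightarrow> nat \<Rightarrow> nat list set" where
  "prefixes_meeting U n = (\<lambda>d. map d [0..<n]) ` {d \<in> avoiding_seqs b m \<omega>. expansion b d \<in> U}"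

definition cylinder :: "nat list \<Rightarrow> real set" where
  "cylinder w = expansion b ` {d \<in> avoiding_seqs b m \<omega>. map d [0..<length w] = w}"

lemma prefixes_meeting_subset: "prefixes_meeting U n \<subseteq> admissible n"
  by (auto simp: prefixes_meeting_def avoiding_seqs_iff)

lemma prefixes_meeting_finite [simp]: "finite (prefixes_meeting U n)"
  by (rule finite_subset[OF prefixes_meeting_subset]) simp

lemma card_prefixes_meeting:
  assumes "bounded U" "diameter U \<le> 1 / real b ^ n"
  shows "card (prefixes_meeting U n) \<le> 5"
  unfolding prefixes_meeting_def
proof (rule card_prefixes_le[OF b_ge_2])
  fix d d' assume "d \<in> {d \<in> avoiding_seqs b m \<omega>. expansion b d \<in> U}"
    "d' \<in> {d \<in> avoiding_seqs b m \<omega>. expansion b d \<in> U}"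
  then have "dist (expansion b d) (expansion b d') \<le> diameter U"
    using diameter_bounded_bound[OF assms(1)] by blast
  then show "\<bar>expansion b d - expansion b d'\<bar> \<le> 1 / real b ^ n"
    using assms(2) by (simp add: dist_real_def)
qed (auto intro: avoiding_seqs_digit)

lemma cylinder_small: "bounded (cylinder w)" "diameter (cylinder w) \<le> 1 / real b ^ length w"
proof -
  have "\<bar>x - y\<bar> \<le> 1 / real b ^ length w" if xy: "x \<in> cylinder w" "y \<in> cylinder w" for x y
  proof -
    obtain d where d: "x = expansion b d" "d \<in> avoiding_seqs b m \<omega>" "map d [0..<length w] = w"
      using xy(1) unfolding cylinder_def by blast
    obtain d' where d': "y = expansion b d'" "d' \<in> avoiding_seqs b m \<omega>" "map d' [0..<length w] = w"
      using xy(2) unfolding cylinder_def by blast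
    show ?thesis unfolding d(1) d'(1)
      by (rule dist_expansion_le[OF b_ge_2 avoiding_seqs_digit[OF d(2)] avoiding_seqs_digit[OF d'(2)]])
        (simp only: d(3) d'(3))
  qed
  then show "bounded (cylinder w)" "diameter (cylinder w) \<le> 1 / real b ^ length w"
    using diameter_le_real[of "1 / real b ^ length w" "cylinder w"] by auto
qed

lemma cylinders_cover: "avoiding_reals b m \<omega> \<subseteq> \<Union>(cylinder ` admissible n)"
proof
  fix x assume "x \<in> avoiding_reals b m \<omega>"
  then obtain d where d: "d \<in> avoiding_seqs b m \<omega>" "x = expansion b d"
    unfolding avoiding_reals_eq by blast
  then have "map d [0..<n] \<in> admissible n" by (simp add: avoiding_seqs_iff)
  moreover have "x \<in> cylinder (map d [0..<n])" using d by (auto simp: cylinder_def)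
  ultimately show "x \<in> \<Union>(cylinder ` admissible n)" by blast
qed

lemma box_covering_number_le:
  assumes "1 / real b ^ n \<le> \<delta>"
  shows "box_covering_number \<delta> (avoiding_reals b m \<omega>) \<le> card (admissible n)"
proof -
  have "bounded U \<and> diameter U \<le> \<delta>" if "U \<in> cylinder ` admissible n" for U
    using that cylinder_small admissible_length assms by (fastforce intro: order.trans)
  then have "box_covering_number \<delta> (avoiding_reals b m \<omega>) \<le> card (cylinder ` admissible n)"
    unfolding box_covering_number_def using cylinders_cover[of n]
    by (intro wellorder_Inf_le1 imageI) auto
  also have "\<dots> \<le> card (admissible n)" by (simp add: card_image_le)
  finally show ?thesis .
qed

lemma card_admissible_le_covering:
  assumes "0 < \<delta>" "\<delta> \<le> 1 / real b ^ n"
  shows "card (admissible n) \<le> 5 * box_covering_number \<delta> (avoiding_reals b m \<omega>)"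
proof -
  let ?K = "avoiding_reals b m \<omega>"
  let ?A = "{\<C>. finite \<C> \<and> ?K \<subseteq> \<Union>\<C> \<and> (\<forall>U\<in>\<C>. bounded U \<and> diameter U \<le> \<delta>)}"
  \<comment> \<open>An infimum of naturals is attained only over a nonempty set; the cylinders of a
    deep level supply a finite cover.\<close>
  obtain k where k: "1 / real b ^ k < \<delta>"
    using eventually_inverse_power_less[OF b_ge_2 assms(1)] by (auto simp: eventually_sequentially)
  have "cylinder ` admissible k \<in> ?A"
    using cylinders_cover[of k] cylinder_small k admissible_length by (fastforce intro: order.trans)
  then have "Inf (card ` ?A) \<in> card ` ?A" by (intro wellorder_InfI) (rule imageI)
  then obtain \<C> where C: "finite \<C>" "?K \<subseteq> \<Union>\<C>" "\<And>U. U \<in> \<C> \<Longrightarrow> bounded U \<and> diameter U \<le> \<delta>"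
    "card \<C> = box_covering_number \<delta> ?K"
    unfolding box_covering_number_def by auto
  have "admissible n \<subseteq> (\<Union>U\<in>\<C>. prefixes_meeting U n)"
  proof
    fix w assume "w \<in> admissible n"
    then obtain d where d: "d \<in> avoiding_seqs b m \<omega>" "w = map d [0..<n]"
      unfolding avoiding_prefixes_eq[symmetric] avoiding_prefixes_def by blast
    then have "expansion b d \<in> \<Union>\<C>" using C(2) unfolding avoiding_reals_eq by blast
    then show "w \<in> (\<Union>U\<in>\<C>. prefixes_meeting U n)" using d by (auto simp: prefixes_meeting_def)
  qed
  then have "card (admissible n) \<le> card (\<Union>U\<in>\<C>. prefixes_meeting U n)"
    using C(1) by (intro card_mono) auto
  also have "\<dots> \<le> (\<Sum>U\<in>\<C>. card (prefixes_meeting U n))" by (rule card_UN_le[OF C(1)])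
  also have "\<dots> \<le> (\<Sum>U\<in>\<C>. 5)"
    using C(3) assms(2) by (intro sum_mono card_prefixes_meeting) (auto intro: order.trans)
  finally show ?thesis using C(4) by simp
qed

text \<open>For positive \<open>n\<close> this is the exponent to base \<open>b ^ n\<close> of the
  number of admissible words; at \<open>n = 0\<close> division by zero makes it
  \<open>0\<close>.\<close>

definition growth_rate :: "nat \<Rightarrow> real" where
  "growth_rate n = ln (real (card (admissible n))) / (real n * ln (real b))"

lemma ln_card_admissible_bounds:
  "0 \<le> ln (real (card (admissible n)))" "ln (real (card (admissible n))) \<le> real n * ln (real b)"
proof -
  have pos: "1 \<le> card (admissible n)" using card_admissible_pos[of n] by linarith
  then show "0 \<le> ln (real (card (admissible n)))" by simp
  have "real (card (admissible n)) \<le> real b ^ n"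
    using card_admissible_le_power[of n] by (metis of_nat_le_iff of_nat_power)
  then have "ln (real (card (admissible n))) \<le> ln (real b ^ n)" using pos by (intro ln_mono) auto
  then show "ln (real (card (admissible n))) \<le> real n * ln (real b)"
    using b_ge by (simp add: ln_realpow)
qed

lemma filterlim_scaled: "filterlim f at_top F \<Longrightarrow> filterlim (\<lambda>t. real (f t) * ln (real b)) at_top F"
  by (rule filterlim_at_top_mult_tendsto_pos[OF tendsto_const ln_b_pos])
    (rule filterlim_compose[OF filterlim_real_sequentially])

text \<open>With \<open>n = scale b \<delta>\<close>, covering number and word count agree up to the
  factors \<open>5\<close> and \<open>b\<close>, and \<open>\<delta>\<close> agrees with
  \<open>1 / b ^ n\<close> up to the factor \<open>b\<close>; hence the common error
  \<open>ln 5 + ln b\<close>.\<close>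

lemma box_counting_tendsto_diff:
  "((\<lambda>\<delta>. ln (real (box_covering_number \<delta> (avoiding_reals b m \<omega>))) / (- ln \<delta>)
      - growth_rate (scale b \<delta>)) \<longlongrightarrow> 0) (at_right 0)"
proof -
  let ?B = "\<lambda>\<delta>. box_covering_number \<delta> (avoiding_reals b m \<omega>)"
  let ?N = "\<lambda>n. card (admissible n)"
  have F: "\<forall>\<^sub>F \<delta> in at_right 0. 0 < \<delta> \<and> \<delta> \<le> (1::real)"
    unfolding eventually_at_right_field by (intro exI[of _ 1]) auto
  have bounds: "\<bar>ln (real (?B \<delta>)) - ln (real (?N n))\<bar> \<le> ln 5 + ln (real b) \<and>
      \<bar>- ln \<delta> - real n * ln (real b)\<bar> \<le> ln 5 + ln (real b)"
    if \<delta>: "0 < \<delta>" "\<delta> \<le> 1" and n: "n = scale b \<delta>" for \<delta> n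
  proof
    note sb = scale_bounds[OF b_ge_2 \<delta>, folded n]
    have N: "0 < ?N n" by (rule card_admissible_pos)
    have l5: "0 \<le> ln (5::real)" by simp
    have "real (?N n) \<le> 5 * real (?B \<delta>)"
      using card_admissible_le_covering[OF \<delta>(1) sb(1)] by (metis of_nat_le_iff of_nat_mult of_nat_numeral)
    moreover from this have B: "0 < real (?B \<delta>)" using N by linarith
    ultimately have "ln (real (?N n)) \<le> ln (5 * real (?B \<delta>))" using N by (intro ln_mono) auto
    then have 1: "ln (real (?N n)) \<le> ln 5 + ln (real (?B \<delta>))" using B by (simp add: ln_mult)
    \<comment> \<open>Cylinders of level \<open>n\<close> may be too large for
      \<open>\<delta>\<close>; those of the next level are not.\<close>
    have "?B \<delta> \<le> ?N (Suc n)" using sb(2) by (intro box_covering_number_le) simp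
    also have "\<dots> \<le> b * ?N n" using card_admissible_growth[of n 1] by simp
    finally have "real (?B \<delta>) \<le> real b * real (?N n)" by (metis of_nat_le_iff of_nat_mult)
    then have "ln (real (?B \<delta>)) \<le> ln (real b * real (?N n))" using B by (intro ln_mono) auto
    then have "ln (real (?B \<delta>)) \<le> ln (real b) + ln (real (?N n))"
      using N b_ge by (simp add: ln_mult)
    then show "\<bar>ln (real (?B \<delta>)) - ln (real (?N n))\<bar> \<le> ln 5 + ln (real b)"
      using 1 ln_b_pos l5 by linarith
    have "ln \<delta> \<le> ln (1 / real b ^ n)" using sb(1) \<delta> by (intro ln_mono) auto
    then have "ln \<delta> \<le> - (real n * ln (real b))" using b_ge by (simp add: ln_div ln_realpow)
    moreover have "ln (1 / real b ^ Suc n) \<le> ln \<delta>" using sb(2) \<delta> b_ge by (intro ln_mono) auto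
    then have "- (real n * ln (real b) + ln (real b)) \<le> ln \<delta>"
      using b_ge by (simp add: ln_div ln_realpow distrib_right del: power_Suc)
    ultimately show "\<bar>- ln \<delta> - real n * ln (real b)\<bar> \<le> ln 5 + ln (real b)"
      using ln_b_pos l5 by linarith
  qed
  show ?thesis
    unfolding growth_rate_def
  proof (rule tendsto_ratio_perturb)
    show "filterlim (\<lambda>\<delta>::real. - ln \<delta>) at_top (at_right 0)"
      using ln_at_0 by (simp add: filterlim_uminus_at_top)
    show "filterlim (\<lambda>\<delta>. real (scale b \<delta>) * ln (real b)) at_top (at_right 0)"
      using filtermap_scale[OF b_ge_2] by (intro filterlim_scaled) (simp add: filterlim_def)
    show "\<forall>\<^sub>F \<delta> in at_right 0. \<bar>ln (real (?B \<delta>)) - ln (real (?N (scale b \<delta>)))\<bar> \<le> ln 5 + ln (real b)"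
      using F by eventually_elim (use bounds in blast)
    show "\<forall>\<^sub>F \<delta> in at_right 0. \<bar>- ln \<delta> - real (scale b \<delta>) * ln (real b)\<bar> \<le> ln 5 + ln (real b)"
      using F by eventually_elim (use bounds in blast)
  qed (use ln_card_admissible_bounds in auto)
qed

lemma lower_box_dim_eq: "lower_box_dim (avoiding_reals b m \<omega>) = liminf (\<lambda>n. ereal (growth_rate n))"
  unfolding lower_box_dim_def Liminf_eq_of_tendsto_diff[OF box_counting_tendsto_diff]
    filtermap_scale[OF b_ge_2, symmetric] Liminf_filtermap ..

lemma upper_box_dim_eq: "upper_box_dim (avoiding_reals b m \<omega>) = limsup (\<lambda>n. ereal (growth_rate n))"
  unfolding upper_box_dim_def Limsup_eq_of_tendsto_diff[OF box_counting_tendsto_diff]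
    filtermap_scale[OF b_ge_2, symmetric] Limsup_filtermap ..

section \<open>Growth of the matrix products\<close>

lemma matrix_growth_tendsto_diff:
  "(\<lambda>n. 1 / (real n * ln (real b)) * ln (entry_norm (adj_mat_prod b m \<omega> n)) - growth_rate n)
     \<longlonglongrightarrow> 0"
proof -
  let ?N = "\<lambda>n. card (admissible n)"
  have bounds: "\<bar>ln (real (?N (n + (m - 1)))) - ln (real (?N n))\<bar> \<le> real (m - 1) * ln (real b)" for n
  proof -
    have N: "0 < ?N n" "0 < ?N (n + (m - 1))" by (rule card_admissible_pos)+
    have "ln (real (?N n)) \<le> ln (real (?N (n + (m - 1))))"
      using N card_admissible_mono by (intro ln_mono) auto
    moreover have "real (?N (n + (m - 1))) \<le> real b ^ (m - 1) * real (?N n)"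
      using card_admissible_growth[of n "m - 1"] by (metis of_nat_le_iff of_nat_mult of_nat_power)
    then have "ln (real (?N (n + (m - 1)))) \<le> ln (real b ^ (m - 1) * real (?N n))"
      using N by (intro ln_mono) auto
    ultimately show ?thesis using N b_ge by (simp add: ln_mult ln_realpow)
  qed
  have top: "filterlim (\<lambda>n. real n * ln (real b)) at_top sequentially"
    by (intro filterlim_scaled filterlim_ident)
  have "(\<lambda>n. ln (real (?N (n + (m - 1)))) / (real n * ln (real b)) - ln (real (?N n)) / (real n * ln (real b)))
     \<longlonglongrightarrow> 0"
    by (rule tendsto_ratio_perturb[OF top top, where C = "real (m - 1) * ln (real b)"])
      (use bounds ln_card_admissible_bounds ln_b_pos in auto)
  then show ?thesis by (simp add: growth_rate_def entry_norm_adj_mat_prod)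
qed

end

section \<open>Hausdorff dimension\<close>

lemma hausdorff_premeasure_le_finite:
  assumes fin: "finite \<C>" and cov: "E \<subseteq> \<Union>\<C>" and \<delta>: "0 \<le> \<delta>"
    and small: "\<And>U. U \<in> \<C> \<Longrightarrow> bounded U \<and> diameter U \<le> \<delta>"
  shows "hausdorff_premeasure s \<delta> E \<le> (\<Sum>U\<in>\<C>. ennreal (diam_powr s U))"
proof -
  obtain h where h: "bij_betw h {0..<card \<C>} \<C>" using ex_bij_betw_nat_finite[OF fin] by blast
  \<comment> \<open>Padding by the empty set is free, since \<open>diam_powr\<close> vanishes there
    even for exponent \<open>0\<close>.\<close>
  define U where "U i = (if i < card \<C> then h i else {})" for i
  have inC: "h i \<in> \<C>" if "i < card \<C>" for i using h that by (auto dest: bij_betwE)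
  have "\<Union>\<C> \<subseteq> (\<Union>i. U i)"
  proof
    fix x assume "x \<in> \<Union>\<C>"
    then obtain i where "i < card \<C>" "x \<in> h i"
      using bij_betw_imp_surj_on[OF h] by (metis UnionE atLeastLessThan_iff imageE)
    then show "x \<in> (\<Union>i. U i)" unfolding U_def by (intro UN_I[of i]) auto
  qed
  then have "U \<in> {U. E \<subseteq> (\<Union>i. U i) \<and> (\<forall>i. bounded (U i) \<and> diameter (U i) \<le> \<delta>)}"
    using cov small inC \<delta> by (auto simp: U_def)
  then have "hausdorff_premeasure s \<delta> E \<le> (\<Sum>i. ennreal (diam_powr s (U i)))"
    unfolding hausdorff_premeasure_def by (rule INF_lower)
  also have "\<dots> = (\<Sum>i<card \<C>. ennreal (diam_powr s (U i)))"
    by (rule suminf_finite) (auto simp: U_def diam_powr_def)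
  also have "\<dots> = (\<Sum>i\<in>{0..<card \<C>}. ennreal (diam_powr s (h i)))"
    by (intro sum.cong) (auto simp: U_def)
  also have "\<dots> = (\<Sum>U\<in>\<C>. ennreal (diam_powr s U))" by (rule sum.reindex_bij_betw[OF h])
  finally show ?thesis .
qed

text \<open>Serves both measures. Knowing the behaviour at every exponent on either side of
  \<open>L\<close> takes the place of monotonicity in the exponent.\<close>

lemma dim_eqI:
  fixes M :: "real \<Rightarrow> ennreal" and L :: ereal
  assumes "0 \<le> L" and above: "\<And>s. L < ereal s \<Longrightarrow> M s = 0"
    and below: "\<And>s. 0 \<le> s \<Longrightarrow> ereal s < L \<Longrightarrow> M s \<noteq> 0"
  shows "Inf {ereal s | s. 0 \<le> s \<and> M s = 0} = L"
proof (rule antisym)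
  show "Inf {ereal s | s. 0 \<le> s \<and> M s = 0} \<le> L"
  proof (rule dense_ge)
    fix y assume "L < y"
    then obtain s where s: "L < ereal s" "ereal s < y" using ereal_dense2 by blast
    then have "0 \<le> s" using \<open>0 \<le> L\<close> by (metis ereal_less_eq(5) less_imp_le order.trans)
    then have "Inf {ereal s | s. 0 \<le> s \<and> M s = 0} \<le> ereal s" using above[OF s(1)] by (intro Inf_lower) blast
    then show "Inf {ereal s | s. 0 \<le> s \<and> M s = 0} \<le> y" using s(2) by simp
  qed
  show "L \<le> Inf {ereal s | s. 0 \<le> s \<and> M s = 0}"
    using below by (intro Inf_greatest) (auto simp: not_less[symmetric])
qed


lemma powr_inverse_power: "0 < b \<Longrightarrow> (1 / real b ^ n) powr s = real b powr (- real n * s)"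
  by (simp add: powr_divide powr_realpow[symmetric] powr_powr powr_minus_divide)

lemma powr_linear_tendsto_0:
  assumes "2 \<le> b" "s < 0" shows "(\<lambda>n. real b powr (real n * s)) \<longlonglongrightarrow> 0"
proof -
  have "(\<lambda>n. (real b powr s) ^ n) \<longlonglongrightarrow> 0"
    using assms by (intro LIMSEQ_realpow_zero) (auto simp: powr_less_one)
  then show ?thesis using assms by (simp add: powr_realpow[symmetric] powr_powr mult.commute)
qed

text \<open>A set of diameter \<open>0\<close>, such as a point, has no comparable scale; the slack
  \<open>\<eta>\<close> pays for it. Otherwise \<open>scale b t\<close> works, and rounding to a
  power of \<open>b\<close> loses the factor \<open>b powr s\<close>.\<close>

lemma comparable_scale:
  assumes b: "2 \<le> b" and t: "0 \<le> t" "t \<le> 1 / real b ^ k" and s: "0 < s" and \<eta>: "0 < \<eta>"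
  obtains n where "k \<le> n" "t \<le> 1 / real b ^ n" "(1 / real b ^ n) powr s \<le> real b powr s * t powr s + \<eta>"
proof (cases "t = 0")
  case True
  have "\<forall>\<^sub>F n in sequentially. real b powr (real n * - s) < \<eta>"
    using order_tendstoD(2)[OF powr_linear_tendsto_0[OF b, of "- s"] \<eta>] s by simp
  then obtain n where n: "k \<le> n" "real b powr (real n * - s) < \<eta>"
    unfolding eventually_sequentially by (metis nat_le_linear)
  have "(1 / real b ^ n) powr s \<le> \<eta>" using n(2) b by (simp add: powr_inverse_power)
  then show ?thesis using that[of n] n(1) True by simp
next
  case False
  have "1 / real b ^ k \<le> 1" using b by (simp add: field_simps)
  then have t': "0 < t" "t \<le> 1" using False t by auto
  define n where "n = scale b t"
  note sb = scale_bounds[OF b t', folded n_def]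
  have "k \<le> n" using le_scale_iff[OF b t', of k] t(2) n_def by simp
  moreover have "1 / real b ^ n \<le> real b * t" using sb(2) b t' by (simp add: field_simps)
  then have "(1 / real b ^ n) powr s \<le> (real b * t) powr s" using s by (intro powr_mono2) auto
  then have "(1 / real b ^ n) powr s \<le> real b powr s * t powr s + \<eta>"
    using t' b \<eta> by (simp add: powr_mult)
  ultimately show ?thesis using that sb(1) by blast
qed

context digit_avoidance
begin

text \<open>The cylinders of one good level \<open>n\<close> have total weight at most
  \<open>b powr (n * (s0 - s))\<close>, so good levels of arbitrary depth suffice.\<close>

lemma hausdorff_measure_eq_0:
  assumes s: "0 \<le> s0" "s0 < s"
    and freq: "\<exists>\<^sub>F n in sequentially. real (card (admissible n)) \<le> real b powr (real n * s0)"
  shows "hausdorff_measure s (avoiding_reals b m \<omega>) = 0"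
proof -
  let ?K = "avoiding_reals b m \<omega>"
  have "hausdorff_premeasure s \<delta> ?K \<le> 0" if \<delta>: "0 < \<delta>" for \<delta>
  proof (rule ennreal_le_epsilon)
    fix e :: real assume e: "0 < e"
    have "\<forall>\<^sub>F n in sequentially. 1 / real b ^ n < \<delta>"
      by (rule eventually_inverse_power_less[OF b_ge_2 \<delta>])
    moreover have "\<forall>\<^sub>F n in sequentially. real b powr (real n * (s0 - s)) < e"
      using order_tendstoD(2)[OF powr_linear_tendsto_0[OF b_ge_2, of "s0 - s"] e] s by simp
    ultimately have "\<forall>\<^sub>F n in sequentially. 1 / real b ^ n < \<delta> \<and> real b powr (real n * (s0 - s)) < e"
      by (rule eventually_conj)
    with freq have "\<exists>\<^sub>F n in sequentially. real (card (admissible n)) \<le> real b powr (real n * s0) \<and>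
        (1 / real b ^ n < \<delta> \<and> real b powr (real n * (s0 - s)) < e)"
      by (rule frequently_eventually_frequently)
    then obtain n where n: "real (card (admissible n)) \<le> real b powr (real n * s0)"
      "1 / real b ^ n < \<delta>" "real b powr (real n * (s0 - s)) < e"
      by (auto dest: frequently_ex)
    let ?C = "cylinder ` admissible n"
    have small: "bounded U \<and> diameter U \<le> 1 / real b ^ n" if "U \<in> ?C" for U
      using that cylinder_small admissible_length by fastforce
    then have "bounded U \<and> diameter U \<le> \<delta>" if "U \<in> ?C" for U
      using that n(2) by (meson less_imp_le order.trans)
    then have "hausdorff_premeasure s \<delta> ?K \<le> (\<Sum>U\<in>?C. ennreal (diam_powr s U))"
      using cylinders_cover[of n] \<delta> by (intro hausdorff_premeasure_le_finite) auto
    also have "\<dots> \<le> (\<Sum>U\<in>?C. ennreal ((1 / real b ^ n) powr s))"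
    proof (intro sum_mono ennreal_leI)
      fix U assume "U \<in> ?C"
      then have "0 \<le> diameter U" "diameter U \<le> 1 / real b ^ n"
        using small by (auto simp: diameter_ge_0)
      then show "diam_powr s U \<le> (1 / real b ^ n) powr s"
        using s by (auto simp: diam_powr_def intro!: powr_mono2)
    qed
    also have "\<dots> = ennreal (real (card ?C) * (1 / real b ^ n) powr s)"
      by (subst sum_ennreal) auto
    also have "\<dots> \<le> ennreal (real b powr (real n * s0) * (1 / real b ^ n) powr s)"
      using card_image_le[of "admissible n" cylinder] n(1)
      by (intro ennreal_leI mult_right_mono) auto
    also have "real b powr (real n * s0) * (1 / real b ^ n) powr s = real b powr (real n * (s0 - s))"
      using b_ge by (simp add: powr_inverse_power powr_add[symmetric] right_diff_distrib)
    also have "ennreal \<dots> \<le> ennreal e" using n(3) by (intro ennreal_leI) simp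
    finally show "hausdorff_premeasure s \<delta> ?K \<le> 0 + ennreal e" by simp
  qed
  then show ?thesis unfolding hausdorff_measure_def by (intro antisym SUP_least) auto
qed

text \<open>
  Compactness of the space of avoiding sequences, by Koenig's lemma: a word is extended as long
  as no finite subfamily covers the sequences that start with it.
\<close>

lemma finite_subcover_avoiding_seqs:
  assumes dep: "\<And>i d d'. d \<in> V i \<Longrightarrow> map d [0..<n i] = map d' [0..<n i] \<Longrightarrow> d' \<in> V i"
    and cov: "avoiding_seqs b m \<omega> \<subseteq> (\<Union>i::nat. V i)"
  obtains k where "avoiding_seqs b m \<omega> \<subseteq> (\<Union>i<k. V i)"
proof (rule ccontr)
  let ?E = "avoiding_seqs b m \<omega>"
  assume "\<not> thesis"
  then have nocov: "\<not> ?E \<subseteq> (\<Union>i<k. V i)" for k using that by blast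
  define bad where "bad w \<longleftrightarrow> (\<forall>k. \<exists>d\<in>?E. map d [0..<length w] = w \<and> d \<notin> (\<Union>i<k. V i))" for w
  have "\<exists>f. \<forall>i. (length (f i) = i \<and> bad (f i)) \<and> (\<exists>x. f (Suc i) = f i @ x)"
  proof (rule dependent_nat_choice)
    show "\<exists>w. length w = 0 \<and> bad w" using nocov by (simp add: bad_def) blast
  next
    fix w i assume w: "length w = i \<and> bad w"
    have "\<exists>a. bad (w @ [a])"
    proof (rule ccontr)
      assume "\<not> ?thesis"
      then have good: "\<not> bad (w @ [a])" for a by blast
      have len: "length (w @ [a]) = Suc i" for a using w by simp
      define covered where "covered a k \<longleftrightarrow>
        (\<forall>d\<in>?E. map d [0..<Suc i] = w @ [a] \<longrightarrow> d \<in> (\<Union>i<k. V i))" for a k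
      have "\<exists>k. covered a k" for a
      proof (rule ccontr)
        assume "\<nexists>k. covered a k"
        then have "\<exists>d\<in>?E. map d [0..<Suc i] = w @ [a] \<and> d \<notin> (\<Union>i<k. V i)" for k
          unfolding covered_def by blast
        then show False using good[of a] unfolding bad_def len by blast
      qed
      then obtain k where "\<And>a. covered a (k a)" by metis
      then have k: "d \<in> (\<Union>i<k a. V i)" if "d \<in> ?E" "map d [0..<Suc i] = w @ [a]" for a d
        using that unfolding covered_def by blast
      \<comment> \<open>The alphabet is finite, so one index bounds the subfamilies needed for all
        one-letter continuations of \<open>w\<close>.\<close>
      obtain d where d: "d \<in> ?E" "map d [0..<i] = w" "d \<notin> (\<Union>i<Max (k ` {..<b}). V i)"
        using w unfolding bad_def by blast
      have "k (d i) \<le> Max (k ` {..<b})" using avoiding_seqs_digit[OF d(1)] by (intro Max_ge) auto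
      moreover have "d \<in> (\<Union>i<k (d i). V i)" using k[OF d(1)] d(2) by simp
      ultimately show False using d(3) by (auto intro: less_le_trans)
    qed
    then obtain a where "bad (w @ [a])" by blast
    then show "\<exists>y. (length y = Suc i \<and> bad y) \<and> (\<exists>x. y = w @ x)"
      using w by (intro exI[of _ "w @ [a]"]) auto
  qed
  then obtain f where f: "\<And>i. length (f i) = i" "\<And>i. bad (f i)" "\<And>i. \<exists>x. f (Suc i) = f i @ x"
    by blast
  have "f i \<in> admissible (length (f i))" for i
  proof -
    obtain d where "d \<in> ?E" "map d [0..<length (f i)] = f i" using f(2)[of i] unfolding bad_def by blast
    then show ?thesis by (metis avoiding_seqs_iff)
  qed
  then obtain d where d: "d \<in> ?E" "\<And>i. map d [0..<length (f i)] = f i"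
    using avoiding_seqs_limit[of f] f by (metis order.refl)
  obtain i where i: "d \<in> V i" using cov d(1) by blast
  \<comment> \<open>\<open>V i\<close> depends on the first \<open>n i\<close> digits only. At that
    depth badness gives a sequence \<open>d'\<close> outside \<open>V i\<close> with the same digits
    as \<open>d\<close>.\<close>
  obtain d' where d': "map d' [0..<n i] = f (n i)" "d' \<notin> (\<Union>j<Suc i. V j)"
    using f(1,2) unfolding bad_def by metis
  have "map d [0..<n i] = map d' [0..<n i]" using d(2)[of "n i"] d'(1) f(1) by simp
  from dep[OF i this] d'(2) show False by blast
qed

lemma card_admissible_le_of_cover:
  assumes cov: "avoiding_seqs b m \<omega> \<subseteq> (\<Union>i\<in>I. {d. map d [0..<n i] \<in> W i})"
    and I: "finite I" and W: "\<And>i. i \<in> I \<Longrightarrow> W i \<subseteq> admissible (n i)"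
  shows "1 \<le> (\<Sum>i\<in>I. real (card (W i)) * (real b ^ (2 * (m - 1)) / real (card (admissible (n i)))))"
proof -
  \<comment> \<open>A common depth below all levels; unlike \<open>Max\<close>, the sum is also
    meaningful for empty \<open>I\<close>.\<close>
  define M where "M = (\<Sum>i\<in>I. n i)"
  have nM: "n i \<le> M" if "i \<in> I" for i unfolding M_def using that I by (intro member_le_sum) auto
  let ?N = "\<lambda>n. card (admissible n)" and ?C = "real b ^ (2 * (m - 1))"
  have "admissible M \<subseteq> (\<Union>i\<in>I. \<Union>w\<in>W i. {u \<in> admissible M. take (n i) u = w})"
  proof
    fix u assume u: "u \<in> admissible M"
    then obtain d where d: "d \<in> avoiding_seqs b m \<omega>" "u = map d [0..<M]"
      unfolding avoiding_prefixes_eq[symmetric] avoiding_prefixes_def by blast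
    then obtain i where i: "i \<in> I" "map d [0..<n i] \<in> W i" using cov by blast
    then have "take (n i) u \<in> W i" using d(2) map_upt_prefix[OF nM[OF i(1)]] by metis
    then show "u \<in> (\<Union>i\<in>I. \<Union>w\<in>W i. {u \<in> admissible M. take (n i) u = w})" using u i by blast
  qed
  then have "?N M \<le> card (\<Union>i\<in>I. \<Union>w\<in>W i. {u \<in> admissible M. take (n i) u = w})"
    by (intro card_mono) (auto intro!: finite_UN_I I finite_subset[OF W])
  also have "\<dots> \<le> (\<Sum>i\<in>I. card (\<Union>w\<in>W i. {u \<in> admissible M. take (n i) u = w}))"
    by (rule card_UN_le[OF I])
  also have "\<dots> \<le> (\<Sum>i\<in>I. \<Sum>w\<in>W i. card {u \<in> admissible M. take (n i) u = w})"
    by (intro sum_mono card_UN_le) (auto intro: finite_subset[OF W])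
  finally have "real (?N M) \<le> (\<Sum>i\<in>I. \<Sum>w\<in>W i. real (card {u \<in> admissible M. take (n i) u = w}))"
    by (metis (mono_tags, lifting) of_nat_le_iff of_nat_sum sum.cong)
  also have "\<dots> \<le> (\<Sum>i\<in>I. \<Sum>w\<in>W i. ?C * real (?N M) / real (?N (n i)))"
  proof (intro sum_mono)
    fix i w assume i: "i \<in> I" and "w \<in> W i"
    then have w: "w \<in> admissible (n i)" using W by blast
    have "card {u \<in> admissible M. take (n i) u = w} = card (extensions w (M - n i))"
      using card_extending[OF w, of "M - n i"] nM[OF i] by simp
    moreover have "?N (n i) * card (extensions w (M - n i)) \<le> b ^ (2 * (m - 1)) * ?N M"
      using card_extensions_upper[OF w, of "M - n i"] nM[OF i] by simp
    then have "real (?N (n i)) * real (card (extensions w (M - n i))) \<le> ?C * real (?N M)"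
      by (metis of_nat_le_iff of_nat_mult of_nat_power)
    ultimately show "real (card {u \<in> admissible M. take (n i) u = w}) \<le> ?C * real (?N M) / real (?N (n i))"
      using card_admissible_pos[of "n i"] by (simp add: pos_le_divide_eq mult.commute)
  qed
  also have "\<dots> = real (?N M) * (\<Sum>i\<in>I. real (card (W i)) * (?C / real (?N (n i))))"
    by (simp add: sum_distrib_left mult_ac)
  finally show ?thesis using card_admissible_pos[of M] by (simp add:)
qed

lemma hausdorff_measure_ne_0:
  assumes s: "0 < s"
    and ev: "\<forall>\<^sub>F n in sequentially. real b powr (real n * s) \<le> real (card (admissible n))"
  shows "hausdorff_measure s (avoiding_reals b m \<omega>) \<noteq> 0"
proof
  let ?K = "avoiding_reals b m \<omega>" and ?C = "real b ^ (2 * (m - 1))"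
  assume zero: "hausdorff_measure s ?K = 0"
  obtain k0 where k0: "\<And>n. k0 \<le> n \<Longrightarrow> real b powr (real n * s) \<le> real (card (admissible n))"
    using ev by (auto simp: eventually_sequentially)
  have C: "0 < ?C" using b_ge by simp
  \<comment> \<open>Makes the final bound \<open>1 / 2\<close>: \<open>5\<close> is the number of
    prefixes met by a small set, \<open>?C\<close> the homogeneity constant, \<open>b powr s\<close>
    the loss in rounding diameters, and the added \<open>1\<close> accounts for slacks
    \<open>e / 2 ^ Suc i\<close> of total at most \<open>e\<close>.\<close>
  define e where "e = 1 / (10 * ?C * (real b powr s + 1))"
  have D: "0 < real b powr s + 1" by (simp add: add_nonneg_pos)
  then have e: "0 < e" unfolding e_def using C by (intro divide_pos_pos mult_pos_pos) auto
  have "real b powr s * e + e = (real b powr s + 1) * e" by (simp add: distrib_right)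
  moreover have "5 * c * (x * (1 / (10 * c * x))) = 1 / 2" if "0 < c" "0 < x" for c x :: real
    using that by (simp add: field_simps)
  ultimately have e_eq: "5 * ?C * (real b powr s * e + e) = 1 / 2"
    using C D unfolding e_def by (simp only:)
  \<comment> \<open>Diameters at most \<open>1 / b ^ k0\<close> allow all levels to be chosen from
    \<open>k0\<close> on, where the growth bound is available.\<close>
  have "hausdorff_premeasure s (1 / real b ^ k0) ?K \<le> hausdorff_measure s ?K"
    unfolding hausdorff_measure_def using b_ge by (intro SUP_upper) simp
  then have "hausdorff_premeasure s (1 / real b ^ k0) ?K < ennreal e" using zero e by simp
  then obtain U where U: "?K \<subseteq> (\<Union>i. U i)" "\<And>i. bounded (U i)" "\<And>i. diameter (U i) \<le> 1 / real b ^ k0"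
    "(\<Sum>i. ennreal (diam_powr s (U i))) < ennreal e"
    unfolding hausdorff_premeasure_def INF_less_iff by auto
  have "\<exists>n. k0 \<le> n \<and> diameter (U i) \<le> 1 / real b ^ n \<and>
      (1 / real b ^ n) powr s \<le> real b powr s * diameter (U i) powr s + e * (1 / 2) ^ Suc i" for i
    by (rule comparable_scale[OF b_ge_2 diameter_ge_0[OF U(2)] U(3) s, of "e * (1 / 2) ^ Suc i" i])
      (use e in auto)
  then obtain n where n: "\<And>i. k0 \<le> n i" "\<And>i. diameter (U i) \<le> 1 / real b ^ n i"
    "\<And>i. (1 / real b ^ n i) powr s \<le> real b powr s * diameter (U i) powr s + e * (1 / 2) ^ Suc i"
    by metis
  \<comment> \<open>The sets \<open>U i\<close> are arbitrary, but lying in \<open>W i\<close> is a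
    condition on finitely many digits. Replacing them gives an open cover of the sequence space, to
    which compactness applies.\<close>
  define W where "W i = prefixes_meeting (U i) (n i)" for i
  have cov: "avoiding_seqs b m \<omega> \<subseteq> (\<Union>i. {d. map d [0..<n i] \<in> W i})"
  proof
    fix d assume d: "d \<in> avoiding_seqs b m \<omega>"
    then obtain i where "expansion b d \<in> U i" using U(1) unfolding avoiding_reals_eq by blast
    then have "map d [0..<n i] \<in> W i" using d by (auto simp: W_def prefixes_meeting_def)
    then show "d \<in> (\<Union>i. {d. map d [0..<n i] \<in> W i})" by blast
  qed
  obtain k where "avoiding_seqs b m \<omega> \<subseteq> (\<Union>i<k. {d. map d [0..<n i] \<in> W i})"
    by (rule finite_subcover_avoiding_seqs[of "\<lambda>i. {d. map d [0..<n i] \<in> W i}" n, OF _ cov])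
      (simp only: mem_Collect_eq, rule that)
  then have "1 \<le> (\<Sum>i<k. real (card (W i)) * (?C / real (card (admissible (n i)))))"
    by (rule card_admissible_le_of_cover) (auto simp: W_def dest: subsetD[OF prefixes_meeting_subset])
  also have "\<dots> \<le> (\<Sum>i<k. 5 * ?C * (real b powr s * diam_powr s (U i) + e * (1 / 2) ^ Suc i))"
  proof (rule sum_mono)
    fix i
    show "real (card (W i)) * (?C / real (card (admissible (n i)))) \<le>
        5 * ?C * (real b powr s * diam_powr s (U i) + e * (1 / 2) ^ Suc i)"
    proof (cases "U i = {}")
      case True
      then show ?thesis using C e by (simp add: W_def prefixes_meeting_def diam_powr_def)
    next
      case False
      have "?C / real (card (admissible (n i))) \<le> ?C / real b powr (real (n i) * s)"
        using k0[OF n(1)] C b_ge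
        by (intro divide_left_mono mult_pos_pos) (auto simp: admissible_nonempty card_gt_0_iff)
      also have "\<dots> = ?C * (1 / real b ^ n i) powr s"
        using b_ge by (simp add: powr_inverse_power powr_minus_divide)
      also have "\<dots> \<le> ?C * (real b powr s * diam_powr s (U i) + e * (1 / 2) ^ Suc i)"
        using n(3)[of i] C False s by (intro mult_left_mono) (auto simp: diam_powr_def)
      finally have "?C / real (card (admissible (n i))) \<le> \<dots>" .
      moreover have "real (card (W i)) \<le> 5"
        using card_prefixes_meeting[OF U(2) n(2)] unfolding W_def by (metis of_nat_le_iff of_nat_numeral)
      ultimately show ?thesis using C
        by (subst mult.assoc) (intro mult_mono, auto)
    qed
  qed
  also have "\<dots> = 5 * ?C * (real b powr s * (\<Sum>i<k. diam_powr s (U i)) + e * (\<Sum>i<k. (1 / 2) ^ Suc i))"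
    by (simp only: sum_distrib_left sum.distrib distrib_left)
  also have "\<dots> \<le> 5 * ?C * (real b powr s * e + e * 1)"
  proof (intro mult_left_mono add_mono)
    have nn: "0 \<le> diam_powr s V" for V :: "real set" by (simp add: diam_powr_def)
    have "ennreal (\<Sum>i<k. diam_powr s (U i)) = (\<Sum>i<k. ennreal (diam_powr s (U i)))"
      by (rule sum_ennreal[symmetric]) (rule nn)
    also have "\<dots> \<le> (\<Sum>i. ennreal (diam_powr s (U i)))" by (intro sum_le_suminf) auto
    finally have "ennreal (\<Sum>i<k. diam_powr s (U i)) < ennreal e" using U(4) by (rule le_less_trans)
    then show "(\<Sum>i<k. diam_powr s (U i)) \<le> e"
      using nn by (subst (asm) ennreal_less_iff) (auto intro: sum_nonneg)
    show "(\<Sum>i<k. (1 / 2 :: real) ^ Suc i) \<le> 1"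
      using sum_le_suminf[of "\<lambda>i. (1 / 2 :: real) ^ Suc i" "{..<k}"] sums_unique[OF power_half_series]
        sums_summable[OF power_half_series] by simp
  qed (use C e in auto)
  also have "\<dots> < 1" using e_eq by simp
  finally show False by simp
qed

text \<open>Exponent \<open>0\<close> counts the nonempty sets of a cover, so a sum below
  \<open>1\<close> would leave only empty ones.\<close>

lemma hausdorff_measure_0_ne_0: "hausdorff_measure 0 (avoiding_reals b m \<omega>) \<noteq> 0"
proof
  let ?K = "avoiding_reals b m \<omega>"
  assume zero: "hausdorff_measure 0 ?K = 0"
  have "hausdorff_premeasure 0 1 ?K \<le> hausdorff_measure 0 ?K"
    unfolding hausdorff_measure_def by (intro SUP_upper) simp
  then have "hausdorff_premeasure 0 1 ?K < 1" using zero by simp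
  then obtain U where U: "?K \<subseteq> (\<Union>i. U i)" "(\<Sum>i. ennreal (diam_powr 0 (U i))) < 1"
    unfolding hausdorff_premeasure_def INF_less_iff by auto
  have "avoiding_seqs b m \<omega> \<noteq> {}"
    using admissible_nonempty[of 0] unfolding avoiding_prefixes_eq[symmetric] avoiding_prefixes_def by blast
  then obtain i where "U i \<noteq> {}" using U(1) unfolding avoiding_reals_eq by blast
  moreover have "ennreal (diam_powr 0 (U i)) < 1" using U(2) by (rule ennreal_suminf_lessD)
  ultimately show False by (simp add: diam_powr_def)
qed

end

section \<open>Packing dimension\<close>

context digit_avoidance
begin

text \<open>Each ball receives a word whose cylinder contains the centre and is smaller than the
  radius. Such a cylinder lies inside the ball, so disjoint balls receive different words. Summing
  over all words of all levels from \<open>k\<close> on leaves a geometric tail.\<close>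

lemma packing_sum_le:
  assumes s: "0 \<le> s" and B: "B \<in> packings (1 / real b ^ k) (avoiding_reals b m \<omega>)"
    and F: "finite F" "F \<subseteq> B"
    and q: "0 < q" "q < 1"
    and N: "\<And>n. k \<le> n \<Longrightarrow> real (card (admissible n)) * (1 / real b ^ n) powr s \<le> q ^ n"
  shows "(\<Sum>(x, r)\<in>F. (2 * r) powr s) \<le> (2 * real b) powr s * (q ^ k / (1 - q))"
proof -
  let ?K = "avoiding_reals b m \<omega>"
  have BK: "x \<in> ?K" "0 < r" "r \<le> 1 / real b ^ k" if "(x, r) \<in> F" for x r
    using B F that by (auto simp: packings_def)
  have disj: "cball x r \<inter> cball x' r' = {}" if "(x, r) \<in> F" "(x', r') \<in> F" "(x, r) \<noteq> (x', r')" for x r x' r'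
  proof -
    have "disjoint_family_on (\<lambda>(x, r). cball x r) B" using B by (simp add: packings_def)
    from disjoint_family_onD[OF this, of "(x, r)" "(x', r')"] show ?thesis using F(2) that by auto
  qed
  have r1: "r \<le> 1" if "(x, r) \<in> F" for x r
  proof -
    have "1 / real b ^ k \<le> 1" using b_ge by (simp add: field_simps)
    then show ?thesis using BK(3)[OF that] by simp
  qed
  have "\<exists>w. k \<le> length w \<and> w \<in> admissible (length w) \<and> x \<in> cylinder w \<and>
      1 / real b ^ length w < r \<and> r \<le> real b / real b ^ length w"
    if xr: "(x, r) \<in> F" for x r
  proof -
    \<comment> \<open>One level beyond \<open>scale b r\<close> makes the cylinder strictly smaller
      than the radius, at the cost of a factor \<open>b\<close>.\<close>
    obtain w where w: "w \<in> admissible (Suc (scale b r))" "x \<in> cylinder w"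
      using BK(1)[OF xr] cylinders_cover[of "Suc (scale b r)"] by blast
    have "k \<le> scale b r" using le_scale_iff[OF b_ge_2 BK(2)[OF xr] r1[OF xr]] BK(3)[OF xr] by blast
    then show ?thesis
      using w admissible_length[OF w(1)] b_ge scale_bounds[OF b_ge_2 BK(2)[OF xr] r1[OF xr]]
      by (intro exI[of _ w]) auto
  qed
  then have "\<forall>p\<in>F. \<exists>w. k \<le> length w \<and> w \<in> admissible (length w) \<and> fst p \<in> cylinder w \<and>
      1 / real b ^ length w < snd p \<and> snd p \<le> real b / real b ^ length w"
    by (auto simp: split_paired_all)
  then obtain f where f: "\<And>p. p \<in> F \<Longrightarrow> k \<le> length (f p)" "\<And>p. p \<in> F \<Longrightarrow> f p \<in> admissible (length (f p))"
    "\<And>p. p \<in> F \<Longrightarrow> fst p \<in> cylinder (f p)" "\<And>p. p \<in> F \<Longrightarrow> 1 / real b ^ length (f p) < snd p"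
    "\<And>p. p \<in> F \<Longrightarrow> snd p \<le> real b / real b ^ length (f p)" by metis
  have inj: "inj_on f F"
  proof (rule inj_onI, rule ccontr)
    fix p p' assume p: "p \<in> F" "p' \<in> F" "f p = f p'" "p \<noteq> p'"
    have "dist (fst p) (fst p') \<le> 1 / real b ^ length (f p)"
      using f(3)[OF p(1)] f(3)[OF p(2)] p(3) cylinder_small[of "f p"] diameter_bounded_bound
      by (metis order.trans)
    then have "fst p' \<in> cball (fst p) (snd p)" using f(4)[OF p(1)] by simp
    moreover have "fst p' \<in> cball (fst p') (snd p')" using BK(2) p(2) by (cases p') (auto intro: less_imp_le)
    ultimately show False using disj[of "fst p" "snd p" "fst p'" "snd p'"] p by auto
  qed
  \<comment> \<open>Adding \<open>k\<close> keeps the set nonempty when \<open>F\<close> is empty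
    and ensures \<open>k \<le> M\<close> for the geometric sum.\<close>
  define M where "M = Max (length ` f ` F \<union> {k})"
  have "f ` F \<subseteq> (\<Union>n\<in>{k..M}. admissible n)"
  proof
    fix w assume "w \<in> f ` F"
    then obtain p where p: "p \<in> F" "w = f p" by blast
    have "length w \<le> M" unfolding M_def using F p by (intro Max_ge) auto
    then show "w \<in> (\<Union>n\<in>{k..M}. admissible n)" using f(1,2)[OF p(1)] p(2) by auto
  qed
  have "(\<Sum>(x, r)\<in>F. (2 * r) powr s) = (\<Sum>p\<in>F. (2 * snd p) powr s)" by (simp add: case_prod_beta)
  also have "\<dots> \<le> (\<Sum>p\<in>F. (2 * real b) powr s * (1 / real b ^ length (f p)) powr s)"
  proof (rule sum_mono)
    fix p assume p: "p \<in> F"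
    have "0 < snd p" using BK(2) p by (cases p) auto
    then have "(2 * snd p) powr s \<le> (2 * real b * (1 / real b ^ length (f p))) powr s"
      using f(5)[OF p] s by (intro powr_mono2) auto
    then show "(2 * snd p) powr s \<le> (2 * real b) powr s * (1 / real b ^ length (f p)) powr s"
      by (subst (asm) powr_mult) auto
  qed
  also have "\<dots> = (\<Sum>w\<in>f ` F. (2 * real b) powr s * (1 / real b ^ length w) powr s)"
    by (simp add: sum.reindex[OF inj])
  also have "\<dots> \<le> (\<Sum>w\<in>(\<Union>n\<in>{k..M}. admissible n). (2 * real b) powr s * (1 / real b ^ length w) powr s)"
    by (rule sum_mono2) (use \<open>f ` F \<subseteq> _\<close> in auto)
  also have "\<dots> = (\<Sum>n\<in>{k..M}. \<Sum>w\<in>admissible n. (2 * real b) powr s * (1 / real b ^ length w) powr s)"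
    by (rule sum.UNION_disjoint) (auto dest: admissible_length)
  also have "\<dots> = (\<Sum>n\<in>{k..M}. (2 * real b) powr s * (real (card (admissible n)) * (1 / real b ^ n) powr s))"
    by (intro sum.cong refl) (simp add: admissible_length)
  also have "\<dots> \<le> (\<Sum>n\<in>{k..M}. (2 * real b) powr s * q ^ n)"
    by (intro sum_mono mult_left_mono N) auto
  also have "\<dots> = (2 * real b) powr s * (\<Sum>n\<in>{k..M}. q ^ n)" by (simp add: sum_distrib_left)
  also have "\<dots> \<le> (2 * real b) powr s * (q ^ k / (1 - q))"
  proof (rule mult_left_mono)
    have "k \<le> M" unfolding M_def using F by (intro Max_ge) auto
    then have "(1 - q) * (\<Sum>n\<in>{k..M}. q ^ n) = q ^ k - q ^ Suc M" by (rule sum_gp_multiplied)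
    also have "\<dots> \<le> q ^ k" using q by simp
    finally show "(\<Sum>n\<in>{k..M}. q ^ n) \<le> q ^ k / (1 - q)" using q by (simp add: pos_le_divide_eq mult.commute)
  qed simp
  finally show ?thesis .
qed

lemma packing_measure_eq_0:
  assumes s: "0 \<le> s" "s0 < s"
    and ev: "\<forall>\<^sub>F n in sequentially. real (card (admissible n)) \<le> real b powr (real n * s0)"
  shows "packing_measure s (avoiding_reals b m \<omega>) = 0"
proof -
  let ?K = "avoiding_reals b m \<omega>"
  define q where "q = real b powr (s0 - s)"
  have q: "0 < q" "q < 1" using b_ge s unfolding q_def by (auto simp: powr_less_one)
  obtain k0 where k0: "\<And>n. k0 \<le> n \<Longrightarrow> real (card (admissible n)) \<le> real b powr (real n * s0)"
    using ev by (auto simp: eventually_sequentially)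
  have N: "real (card (admissible n)) * (1 / real b ^ n) powr s \<le> q ^ n" if "k0 \<le> n" for n
  proof -
    have "real (card (admissible n)) * (1 / real b ^ n) powr s
        \<le> real b powr (real n * s0) * (1 / real b ^ n) powr s"
      using k0[OF that] by (intro mult_right_mono) auto
    also have "\<dots> = real b powr (real n * (s0 - s))"
      using b_ge by (simp add: powr_inverse_power powr_add[symmetric] right_diff_distrib)
    also have "\<dots> = q ^ n"
      using b_ge by (simp add: q_def powr_realpow[symmetric] powr_powr mult.commute)
    finally show ?thesis .
  qed
  have "packing_premeasure s ?K \<le> 0"
  proof (rule ennreal_le_epsilon)
    fix e :: real assume e: "0 < e"
    have "(\<lambda>k. (2 * real b) powr s * (q ^ k / (1 - q))) \<longlonglongrightarrow> (2 * real b) powr s * (0 / (1 - q))"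
      using q by (intro tendsto_intros LIMSEQ_realpow_zero) auto
    then have "\<forall>\<^sub>F k in sequentially. (2 * real b) powr s * (q ^ k / (1 - q)) < e"
      using order_tendstoD(2)[of _ _ _ e] e by simp
    then obtain k where k: "k0 \<le> k" "(2 * real b) powr s * (q ^ k / (1 - q)) < e"
      unfolding eventually_sequentially by (metis nat_le_linear)
    have "packing_premeasure s ?K \<le>
        (SUP B\<in>packings (1 / real b ^ k) ?K. \<Sum>\<^sub>\<infinity>(x, r)\<in>B. ennreal ((2 * r) powr s))"
      unfolding packing_premeasure_def using b_ge by (intro INF_lower) simp
    also have "\<dots> \<le> ennreal e"
    proof (rule SUP_least, rule infsum_le_finite_sums)
      fix B F assume B: "B \<in> packings (1 / real b ^ k) ?K" and F: "finite F" "F \<subseteq> B"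
      have "(\<Sum>(x, r)\<in>F. ennreal ((2 * r) powr s)) = ennreal (\<Sum>(x, r)\<in>F. (2 * r) powr s)"
        by (simp add: case_prod_beta)
      also have "\<dots> \<le> ennreal e"
        using packing_sum_le[OF s(1) B F q N] k by (intro ennreal_leI) simp
      finally show "(\<Sum>(x, r)\<in>F. ennreal ((2 * r) powr s)) \<le> ennreal e" .
    qed (simp add: nonneg_summable_on_complete)
    finally show "packing_premeasure s ?K \<le> 0 + ennreal e" by simp
  qed
  then have "packing_premeasure s ?K = 0" by simp
  \<comment> \<open>The cover consists of copies of the whole set, whose premeasure already
    vanishes.\<close>
  moreover have "packing_measure s ?K \<le> (\<Sum>i::nat. packing_premeasure s ?K)"
    unfolding packing_measure_def by (rule INF_lower) simp
  ultimately show ?thesis by simp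
qed

text \<open>Balls of radius \<open>1 / b ^ n\<close> around well separated points of
  \<open>U\<close> form a packing, so a premeasure below \<open>1\<close> bounds their number by
  \<open>b powr (n * s)\<close>. The factor \<open>4\<close> is the price of separation.\<close>

lemma card_prefixes_meeting_le_of_premeasure:
  assumes s: "0 \<le> s" and U: "packing_premeasure s U < 1"
  obtains k where "\<And>n. k \<le> n \<Longrightarrow> real (card (prefixes_meeting U n)) \<le> 4 * real b powr (real n * s)"
proof -
  obtain \<delta> where \<delta>: "0 < \<delta>" "(SUP B\<in>packings \<delta> U. \<Sum>\<^sub>\<infinity>(x, r)\<in>B. ennreal ((2 * r) powr s)) < 1"
    using U unfolding packing_premeasure_def INF_less_iff by auto
  obtain k where k: "\<And>n. k \<le> n \<Longrightarrow> 1 / real b ^ n < \<delta>"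
    using eventually_inverse_power_less[OF b_ge_2 \<delta>(1)] by (auto simp: eventually_sequentially)
  have "real (card (prefixes_meeting U n)) \<le> 4 * real b powr (real n * s)" if n: "k \<le> n" for n
  proof -
    let ?S = "{d \<in> avoiding_seqs b m \<omega>. expansion b d \<in> U}"
    have digits: "d i < b" if "d \<in> ?S" for d i using that avoiding_seqs_digit by blast
    have "\<exists>T\<subseteq>?S. finite T \<and> card (prefixes_meeting U n) \<le> 4 * card T \<and>
      (\<forall>d\<in>T. \<forall>d'\<in>T. d \<noteq> d' \<longrightarrow> 3 / real b ^ n \<le> \<bar>expansion b d - expansion b d'\<bar>)"
    proof (rule separated_subset[OF b_ge_2, of ?S n])
      fix T assume "T \<subseteq> ?S" "finite T" "card ((\<lambda>d. map d [0..<n]) ` ?S) \<le> 4 * card T"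
        "\<And>d d'. d \<in> T \<Longrightarrow> d' \<in> T \<Longrightarrow> d \<noteq> d' \<Longrightarrow> 3 / real b ^ n \<le> \<bar>expansion b d - expansion b d'\<bar>"
      then show ?thesis unfolding prefixes_meeting_def by (intro exI[of _ T] conjI ballI impI) simp_all
    qed (rule digits)
    then obtain T where T: "T \<subseteq> ?S" "finite T" "card (prefixes_meeting U n) \<le> 4 * card T"
      "\<And>d d'. d \<in> T \<Longrightarrow> d' \<in> T \<Longrightarrow> d \<noteq> d' \<Longrightarrow> 3 / real b ^ n \<le> \<bar>expansion b d - expansion b d'\<bar>"
      by (elim exE conjE) simp
    let ?r = "1 / real b ^ n"
    define B where "B = (\<lambda>d. (expansion b d, ?r)) ` T"
    have r: "0 < ?r" using b_ge by simp
    have sep: "2 * ?r < \<bar>expansion b d - expansion b d'\<bar>" if "d \<in> T" "d' \<in> T" "d \<noteq> d'" for d d'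
    proof -
      have "2 * ?r < 3 / real b ^ n" using b_ge by (simp add: divide_strict_right_mono)
      then show ?thesis using T(4)[OF that] by linarith
    qed
    have inj: "inj_on (\<lambda>d. (expansion b d, ?r)) T"
    proof (rule inj_onI, rule ccontr)
      fix d d' assume d: "d \<in> T" "d' \<in> T" "(expansion b d, ?r) = (expansion b d', ?r)" "d \<noteq> d'"
      then show False using sep[OF d(1,2,4)] r by simp
    qed
    have "cball (expansion b d) ?r \<inter> cball (expansion b d') ?r = {}" if "d \<in> T" "d' \<in> T" "d \<noteq> d'" for d d'
      by (rule disjoint_cballI) (use sep[OF that] in \<open>simp add: dist_real_def\<close>)
    then have "B \<in> packings \<delta> U"
      using T(1,2) r k[OF n] unfolding packings_def B_def disjoint_family_on_def
      by (auto simp: countable_finite less_imp_le)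
    then have "(\<Sum>\<^sub>\<infinity>(x, r)\<in>B. ennreal ((2 * r) powr s)) < 1"
      using \<delta>(2) by (meson SUP_upper le_less_trans)
    moreover have "(\<Sum>\<^sub>\<infinity>(x, r)\<in>B. ennreal ((2 * r) powr s)) = (\<Sum>d\<in>T. ennreal ((2 * ?r) powr s))"
      using T(2) by (simp add: B_def sum.reindex[OF inj])
    ultimately have "ennreal (real (card T) * (2 * ?r) powr s) < ennreal 1"
      by (subst (asm) sum_ennreal) auto
    then have "real (card T) * (2 * ?r) powr s < 1" by (subst (asm) ennreal_less_iff) auto
    moreover have "real (card T) * ?r powr s \<le> real (card T) * (2 * ?r) powr s"
      using r s by (intro mult_left_mono powr_mono2; linarith)
    ultimately have "real (card T) * ?r powr s \<le> 1" by linarith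
    then have "real (card T) \<le> real b powr (real n * s)"
      using b_ge by (simp add: powr_inverse_power powr_minus_divide pos_divide_le_eq)
    moreover have "real (card (prefixes_meeting U n)) \<le> 4 * real (card T)"
      using T(3) by (metis of_nat_le_iff of_nat_mult of_nat_numeral)
    ultimately show ?thesis by linarith
  qed
  then show ?thesis using that by blast
qed

text \<open>
  A Baire category argument: if countably many pieces of small packing premeasure covered the
  set, then each of them would meet too few cylinders to fill any given one, and one could
  successively leave all the pieces.
\<close>

lemma packing_measure_ne_0:
  assumes s: "0 \<le> s" "s < s1"
    and freq: "\<exists>\<^sub>F n in sequentially. real b powr (real n * s1) \<le> real (card (admissible n))"
  shows "packing_measure s (avoiding_reals b m \<omega>) \<noteq> 0"
proof
  let ?K = "avoiding_reals b m \<omega>" and ?C = "real b ^ (2 * (m - 1))"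
  let ?N = "\<lambda>n. card (admissible n)"
  assume "packing_measure s ?K = 0"
  then have "packing_measure s ?K < 1" by simp
  then obtain U where U: "?K \<subseteq> (\<Union>i. U i)" "(\<Sum>i. packing_premeasure s (U i)) < 1"
    unfolding packing_measure_def INF_less_iff by auto
  have "\<exists>k. \<forall>n\<ge>k. real (card (prefixes_meeting (U i) n)) \<le> 4 * real b powr (real n * s)" for i
    using card_prefixes_meeting_le_of_premeasure[OF s(1) ennreal_suminf_lessD[OF U(2)], of i] by metis
  then obtain k where k: "\<And>i n. k i \<le> n \<Longrightarrow> real (card (prefixes_meeting (U i) n)) \<le> 4 * real b powr (real n * s)"
    by metis
  \<comment> \<open>A word outside \<open>prefixes_meeting (U i)\<close> excludes every avoiding
    sequence that begins with it, so the limit stays outside \<open>U i\<close> whatever the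
    topology of that piece.\<close>
  have "\<exists>f. \<forall>i. (i \<le> length (f i) \<and> f i \<in> admissible (length (f i))) \<and>
      ((\<exists>x. f (Suc i) = f i @ x) \<and> f (Suc i) \<notin> prefixes_meeting (U i) (length (f (Suc i))))"
  proof (rule dependent_nat_choice)
    obtain w where "w \<in> admissible 0" using admissible_nonempty[of 0] by blast
    then show "\<exists>w. 0 \<le> length w \<and> w \<in> admissible (length w)"
      using admissible_length by (intro exI[of _ w]) fastforce
  next
    fix w i assume w: "i \<le> length w \<and> w \<in> admissible (length w)"
    let ?l = "length w"
    have "0 < ?C * real (?N ?l)" using b_ge card_admissible_pos[of ?l] by simp
    then have "\<forall>\<^sub>F n in sequentially. real b powr (real n * (s - s1)) < 1 / (4 * (?C * real (?N ?l)))"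
      using order_tendstoD(2)[OF powr_linear_tendsto_0[OF b_ge_2, of "s - s1"]] s by simp
    moreover have "\<forall>\<^sub>F n in sequentially. max (k i) (Suc ?l) \<le> n" by (rule eventually_ge_at_top)
    ultimately have "\<forall>\<^sub>F n in sequentially. real b powr (real n * (s - s1)) < 1 / (4 * (?C * real (?N ?l))) \<and>
        max (k i) (Suc ?l) \<le> n" by (rule eventually_conj)
    with freq have "\<exists>\<^sub>F n in sequentially. real b powr (real n * s1) \<le> real (?N n) \<and>
      (real b powr (real n * (s - s1)) < 1 / (4 * (?C * real (?N ?l))) \<and> max (k i) (Suc ?l) \<le> n)"
      by (rule frequently_eventually_frequently)
    then obtain n where n: "real b powr (real n * s1) \<le> real (?N n)"
      "real b powr (real n * (s - s1)) < 1 / (4 * (?C * real (?N ?l)))" "k i \<le> n" "Suc ?l \<le> n"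
      by (auto dest: frequently_ex)
    let ?X = "(@) w ` extensions w (n - ?l)"
    \<comment> \<open>\<open>U i\<close> meets at most \<open>4 * b powr (n * s)\<close> words of
      level \<open>n\<close>, while \<open>w\<close> alone has at least
      \<open>?N n / (?C * ?N ?l)\<close> extensions. The gap between \<open>s\<close> and
      \<open>s1\<close> makes the second number larger at the chosen level.\<close>
    have "4 * real b powr (real n * s) * (?C * real (?N ?l))
        = real b powr (real n * s1) * (real b powr (real n * (s - s1)) * (4 * (?C * real (?N ?l))))"
      by (simp add: right_diff_distrib powr_diff)
    also have "\<dots> < real b powr (real n * s1) * 1"
      using n(2) \<open>0 < ?C * real (?N ?l)\<close> b_ge by (intro mult_strict_left_mono) (auto simp: pos_less_divide_eq)
    also have "\<dots> \<le> real (?N n)" using n(1) by simp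
    also have "\<dots> \<le> real (card (extensions w (n - ?l))) * (?C * real (?N ?l))"
    proof -
      have "?N n \<le> b ^ (2 * (m - 1)) * ?N ?l * card (extensions w (n - ?l))"
        using card_extensions_lower[of w ?l "n - ?l"] w n(4) by simp
      then have "real (?N n) \<le> real (b ^ (2 * (m - 1)) * ?N ?l * card (extensions w (n - ?l)))"
        by (simp only: of_nat_le_iff)
      then show ?thesis by (simp add: mult_ac)
    qed
    finally have "4 * real b powr (real n * s) < real (card (extensions w (n - ?l)))"
      using \<open>0 < ?C * real (?N ?l)\<close> by (simp add: mult_less_cancel_right_pos)
    then have "card (prefixes_meeting (U i) n) < card (extensions w (n - ?l))"
      using k[OF n(3)] by linarith
    also have "\<dots> = card ?X" by (rule card_image[symmetric]) (simp add: inj_on_def)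
    finally have "\<not> ?X \<subseteq> prefixes_meeting (U i) n" using card_mono[of "prefixes_meeting (U i) n" ?X] by auto
    then obtain x where x: "x \<in> extensions w (n - ?l)" "w @ x \<notin> prefixes_meeting (U i) n" by blast
    have "w @ x \<in> admissible n" using x(1) n(4) by (simp add: extensions_def)
    moreover from this have "length (w @ x) = n" by (rule admissible_length)
    ultimately show "\<exists>y. (Suc i \<le> length y \<and> y \<in> admissible (length y)) \<and>
        ((\<exists>x. y = w @ x) \<and> y \<notin> prefixes_meeting (U i) (length y))"
      using x(2) n(4) w by (intro exI[of _ "w @ x"]) auto
  qed
  then obtain f where f: "\<And>i. i \<le> length (f i)" "\<And>i. f i \<in> admissible (length (f i))"
    "\<And>i. \<exists>x. f (Suc i) = f i @ x" "\<And>i. f (Suc i) \<notin> prefixes_meeting (U i) (length (f (Suc i)))"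
    by blast
  obtain d where d: "d \<in> avoiding_seqs b m \<omega>" "\<And>i. map d [0..<length (f i)] = f i"
    using avoiding_seqs_limit[OF f(3) f(1) f(2)] by blast
  then obtain i where "expansion b d \<in> U i" using U(1) unfolding avoiding_reals_eq by blast
  then have "map d [0..<length (f (Suc i))] \<in> prefixes_meeting (U i) (length (f (Suc i)))"
    using d(1) by (auto simp: prefixes_meeting_def)
  then show False using f(4)[of i] d(2)[of "Suc i"] by simp
qed

end

section \<open>From critical exponents to dimensions\<close>

context digit_avoidance
begin

lemma growth_rate_nonneg: "0 \<le> growth_rate n"
  using ln_card_admissible_bounds(1) ln_b_pos by (simp add: growth_rate_def)

lemma card_admissible_eq_powr:
  "0 < n \<Longrightarrow> real (card (admissible n)) = real b powr (real n * growth_rate n)"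
  using card_admissible_pos[of n] ln_b_pos b_ge
  by (simp add: growth_rate_def powr_def)

lemma card_admissible_le_powr_iff:
  assumes "0 < n"
  shows "real (card (admissible n)) \<le> real b powr (real n * s) \<longleftrightarrow> growth_rate n \<le> s"
  using assms b_ge by (simp add: card_admissible_eq_powr)

lemma powr_le_card_admissible_iff:
  assumes "0 < n"
  shows "real b powr (real n * s) \<le> real (card (admissible n)) \<longleftrightarrow> s \<le> growth_rate n"
  using assms b_ge by (simp add: card_admissible_eq_powr)

lemma hausdorff_dim_eq: "hausdorff_dim (avoiding_reals b m \<omega>) = liminf (\<lambda>n. ereal (growth_rate n))"
  unfolding hausdorff_dim_def
proof (rule dim_eqI)
  show nonneg: "0 \<le> liminf (\<lambda>n. ereal (growth_rate n))"
    by (rule Liminf_bounded) (simp add: growth_rate_nonneg)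
  fix s
  show "hausdorff_measure s (avoiding_reals b m \<omega>) = 0" if less: "liminf (\<lambda>n. ereal (growth_rate n)) < ereal s"
  proof -
    \<comment> \<open>An exponent strictly in between is needed because the covering sums decay like
      \<open>b powr (n * (s0 - s))\<close>.\<close>
    obtain s0 where s0: "liminf (\<lambda>n. ereal (growth_rate n)) < ereal s0" "ereal s0 < ereal s"
      using ereal_dense2[OF less] by blast
    have "\<exists>\<^sub>F n in sequentially. real (card (admissible n)) \<le> real b powr (real n * s0)"
    proof (rule ccontr)
      assume "\<not> ?thesis"
      then have "\<forall>\<^sub>F n in sequentially. \<not> real (card (admissible n)) \<le> real b powr (real n * s0)"
        by (simp only: not_frequently)
      then have "\<forall>\<^sub>F n in sequentially. ereal s0 \<le> ereal (growth_rate n)"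
        using eventually_gt_at_top[of 0] by eventually_elim (simp add: card_admissible_le_powr_iff)
      then have "ereal s0 \<le> liminf (\<lambda>n. ereal (growth_rate n))" by (rule Liminf_bounded)
      then show False using s0(1) by simp
    qed
    moreover have "0 \<le> ereal s0" using nonneg s0(1) by (meson less_imp_le order.trans)
    ultimately show ?thesis using s0(2) by (intro hausdorff_measure_eq_0[of s0 s]) auto
  qed
  show "hausdorff_measure s (avoiding_reals b m \<omega>) \<noteq> 0"
    if "0 \<le> s" and less: "ereal s < liminf (\<lambda>n. ereal (growth_rate n))"
  proof (cases "s = 0")
    case False
    have "\<forall>\<^sub>F n in sequentially. ereal s < ereal (growth_rate n)" using less by (rule less_LiminfD)
    then have "\<forall>\<^sub>F n in sequentially. real b powr (real n * s) \<le> real (card (admissible n))"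
      using eventually_gt_at_top[of 0] by eventually_elim (simp add: powr_le_card_admissible_iff)
    then show ?thesis using False that by (intro hausdorff_measure_ne_0) auto
  qed (simp add: hausdorff_measure_0_ne_0)
qed

lemma packing_dim_eq: "packing_dim (avoiding_reals b m \<omega>) = limsup (\<lambda>n. ereal (growth_rate n))"
  unfolding packing_dim_def
proof (rule dim_eqI)
  show nonneg: "0 \<le> limsup (\<lambda>n. ereal (growth_rate n))"
    by (rule le_Limsup) (simp_all add: growth_rate_nonneg)
  fix s
  show "packing_measure s (avoiding_reals b m \<omega>) = 0" if less: "limsup (\<lambda>n. ereal (growth_rate n)) < ereal s"
  proof -
    obtain s0 where s0: "limsup (\<lambda>n. ereal (growth_rate n)) < ereal s0" "ereal s0 < ereal s"
      using ereal_dense2[OF less] by blast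
    have "\<forall>\<^sub>F n in sequentially. ereal (growth_rate n) < ereal s0" using s0(1) by (rule Limsup_lessD)
    then have "\<forall>\<^sub>F n in sequentially. real (card (admissible n)) \<le> real b powr (real n * s0)"
      using eventually_gt_at_top[of 0] by eventually_elim (simp add: card_admissible_le_powr_iff)
    moreover have "0 \<le> ereal s" using nonneg less by (meson less_imp_le order.trans)
    ultimately show ?thesis using s0(2) by (intro packing_measure_eq_0[of s s0]) auto
  qed
  show "packing_measure s (avoiding_reals b m \<omega>) \<noteq> 0"
    if "0 \<le> s" and less: "ereal s < limsup (\<lambda>n. ereal (growth_rate n))"
  proof -
    obtain s1 where s1: "ereal s < ereal s1" "ereal s1 < limsup (\<lambda>n. ereal (growth_rate n))"
      using ereal_dense2[OF less] by blast
    have "\<exists>\<^sub>F n in sequentially. real b powr (real n * s1) \<le> real (card (admissible n))"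
    proof (rule ccontr)
      assume "\<not> ?thesis"
      then have "\<forall>\<^sub>F n in sequentially. \<not> real b powr (real n * s1) \<le> real (card (admissible n))"
        by (simp only: not_frequently)
      then have "\<forall>\<^sub>F n in sequentially. ereal (growth_rate n) \<le> ereal s1"
        using eventually_gt_at_top[of 0] by eventually_elim (simp add: powr_le_card_admissible_iff)
      then have "limsup (\<lambda>n. ereal (growth_rate n)) \<le> ereal s1" by (rule Limsup_bounded)
      then show False using s1(2) by simp
    qed
    then show ?thesis using s1(1) that(1) by (intro packing_measure_ne_0[of s s1]) auto
  qed
qed

end

theorem theorem1p1:
  fixes b m :: nat and \<omega> :: "nat \<Rightarrow> nat list"
  assumes "b \<ge> 3" and "m \<ge> 2"
    and "\<forall>k. \<omega> k \<in> words b m"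
  shows
    "(hausdorff_dim (avoiding_reals b m \<omega>) = lower_box_dim (avoiding_reals b m \<omega>)
      \<and> lower_box_dim (avoiding_reals b m \<omega>)
        = liminf (\<lambda>n. ereal (ln (real (card (avoiding_prefixes b m \<omega> n))) / (real n * ln (real b))))
      \<and> liminf (\<lambda>n. ereal (ln (real (card (avoiding_prefixes b m \<omega> n))) / (real n * ln (real b))))
        = liminf (\<lambda>n. ereal (1 / (real n * ln (real b)) * ln (entry_norm (adj_mat_prod b m \<omega> n)))))
     \<and>
     (packing_dim (avoiding_reals b m \<omega>) = upper_box_dim (avoiding_reals b m \<omega>)
      \<and> upper_box_dim (avoiding_reals b m \<omega>)
        = limsup (\<lambda>n. ereal (ln (real (card (avoiding_prefixes b m \<omega> n))) / (real n * ln (real b))))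
      \<and> limsup (\<lambda>n. ereal (ln (real (card (avoiding_prefixes b m \<omega> n))) / (real n * ln (real b))))
        = limsup (\<lambda>n. ereal (1 / (real n * ln (real b)) * ln (entry_norm (adj_mat_prod b m \<omega> n)))))"
proof -
  interpret digit_avoidance b m \<omega> using assms by unfold_locales
  have "ln (real (card (avoiding_prefixes b m \<omega> n))) / (real n * ln (real b)) = growth_rate n" for n
    by (simp only: growth_rate_def avoiding_prefixes_eq)
  then show ?thesis
    unfolding hausdorff_dim_eq packing_dim_eq lower_box_dim_eq upper_box_dim_eq
      Liminf_eq_of_tendsto_diff[OF matrix_growth_tendsto_diff]
      Limsup_eq_of_tendsto_diff[OF matrix_growth_tendsto_diff]
    by simp
qed

end
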